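(* Suppose that Assumption A1 holds for some $T_1,\mathcal{N}_1$ and Assumption A2 holds for some $T_2,\mathcal{N}_2$, with $M_2=\begin{pmatrix}M_{21}&M_{22}\\ M_{23}&M_{24}\end{pmatrix}$ ($M_{21}\in\mathbb{R}^{n_q\times n_q}$, $M_{24}\in\mathbb{R}^{n_p\times n_p}$) a $\delta$-MM for $p$ and $M_{24}<0$. Suppose there exist $\alpha_1,\alpha_2,\mu_1,\mu_2>0$ and matrices $R_1,R_2,R_3,R_4$, $P_1=P_1^\top>0$, $P_2=P_2^\top>0$, $X_1=X_1^\top>0$, $Y_1=Y_1^\top$, $X_2=X_2^\top>0$, $Y_2=Y_2^\top>0$ with $(X_1,Y_1)\in\mathcal{N}_1$, $(X_2,Y_2)\in\mathcal{N}_2$ and \[ \begin{pmatrix}\Phi-\varphi^\top Y_1\varphi & \phi^\top\\ \phi & -X_1\end{pmatrix}\leq 0,\qquad \begin{pmatrix}\Psi-\varphi^\top Y_2\varphi & \psi^\top\\ \psi & -X_2\end{pmatrix}\leq 0, \] where $\Phi=\begin{pmatrix}\Phi_0 & -P_1\tilde E_1 & P_1 E_w+R_1F_w\\ * & \mathbf{0} & \mathbf{0}\\ * & * & -\mu_1I\end{pmatrix}$, $\Phi_0=\tilde A_1^\top P_1+P_1\tilde A_1+C^\top R_1^\top+R_1C+\alpha_1P_1$, $\Psi=\begin{pmatrix}\Psi_0 & \tilde E_2Y_2+BR_4 & E_w\\ * & \mathbf{0} & \mathbf{0}\\ * & * & -\mu_2I\end{pmatrix}$, $\Psi_0=\tilde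 A_2P_2+P_2\tilde A_2^\top+BR_3+R_3^\top B^\top+\alpha_2P_2$, $\phi=(-(X_1\Gamma_{11}C_q+R_2C),\ X_1\Gamma_{12},\ -R_2F_w)$, $\varphi=(\mathbf{0}_{n_p\times n_x},I_{n_p},\mathbf{0}_{n_p\times n_w})$, $\psi=(\Gamma_{21}C_qP_2,\ \Gamma_{22}Y_2,\ \mathbf{0}_{n_q\times n_w})$, $\tilde A_i=A-ET_{i4}^{-1}T_{i3}C_q$, $\tilde E_i=ET_{i4}^{-1}$, $\Gamma_{i1}=T_{i1}-T_{i2}T_{i4}^{-1}T_{i3}$, $\Gamma_{i2}=T_{i2}T_{i4}^{-1}$ ($i=1,2$). If $L_1=\Gamma_{11}^{-1}X_1^{-1}R_2$, $L_2=P_1^{-1}R_1+ET_{14}^{-1}T_{13}L_1$, $K_1=R_3P_2^{-1}+K_2T_{24}^{-1}T_{23}C_q$, $K_2=R_4Y_2^{-1}T_{24}$, then the closed-loop system is ISS w.r.t. $w$.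
   Context: Consider the nonlinear system $\dot x=Ax+Bu+Ep(q)+E_ww$, $y=Cx+Du+F_ww$, $q=C_qx$, with $x\in\mathbb{R}^{n_x}$, $u\in\mathbb{R}^{n_u}$, $y\in\mathbb{R}^{n_y}$, $w\in\mathbb{R}^{n_w}$, and $p:\mathbb{R}^{n_q}\to\mathbb{R}^{n_p}$, $p(\mathbf{0})=\mathbf{0}$. A symmetric $M$ is a $\delta$-MM for $p$ if $\begin{pmatrix}\delta q\\ \delta p\end{pmatrix}^\top M\begin{pmatrix}\delta q\\ \delta p\end{pmatrix}\geq0$ for all $q_1,q_2$, with $\delta q=q_2-q_1$, $\delta p=p(q_2)-p(q_1)$. Assumption A1: there exist a set $\mathcal{N}_1$ of pairs $(X_1,Y_1)$, $X_1\in\mathbb{R}^{n_q\times n_q}$, $Y_1\in\mathbb{R}^{n_p\times n_p}$ symmetric, and an invertible $T_1=\begin{pmatrix}T_{11}&T_{12}\\ T_{13}&T_{14}\end{pmatrix}$ with $T_{14}\in\mathbb{R}^{n_p\times n_p}$ invertible, such that $M_1=T_1^\top\begin{pmatrix}X_1&\mathbf{0}\\ \mathbf{0}&-Y_1\end{pmatrix}T_1$ is a $\delta$-MM of $p$ for all $(X_1,Y_1)\in\mathcal{N}_1$. Assumption A2: there exist a set $\mathcal{N}_2$ of pairs $(X_2,Y_2)$, $X_2\in\mathbb{R}^{n_q\times n_q}$, $Y_2\in\mathbb{R}^{n_p\times n_p}$ symmetric and invertible, and an invertible $T_2=\begin{pmatrix}T_{21}&T_{22}\\ T_{23}&T_{24}\end{pmatrix}$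 with $T_{24}$ invertible, such that $M_2=T_2^\top\begin{pmatrix}X_2^{-1}&\mathbf{0}\\ \mathbf{0}&-Y_2^{-1}\end{pmatrix}T_2$ is a $\delta$-MM of $p$ for all $(X_2,Y_2)\in\mathcal{N}_2$. Observer: $\dot{\hat x}=A\hat x+Bu+Ep(\hat q+L_1(\hat y-y))+L_2(\hat y-y)$, $\hat y=C\hat x+Du$, $\hat q=C_q\hat x$; controller $u=K_1\hat x+K_2p(C_q\hat x)$. With $e=x-\hat x$, the closed loop is $\dot x=(A+BK_1)x+(E+BK_2)p-B\Delta k+E_ww$, $\dot e=(A+L_2C)e-E\delta p+(E_w+L_2F_w)w$, where $\Delta k=K_1e-K_2(p(\hat q)-p(q))$, $\delta p=p(q+\delta q)-p(q)$, $\delta q=-(C_q+L_1C)e-L_1F_ww$. ISS w.r.t. $w$ means there exist $\beta\in\mathcal{KL}$, $\gamma\in\mathcal{K}$ with $\|(x,e)(t)\|\leq\beta(\|(x,e)(0)\|,t)+\gamma(\|w\|_\infty)$. *)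

theory Defs
  imports "HOL-Analysis.Analysis"
begin

section \<open>Block matrices over sum index types\<close>

definition blk :: "real^'b::finite^'a::finite \<Rightarrow> real^'d^'a \<Rightarrow> real^'b^'c \<Rightarrow> real^'d::finite^'c::finite \<Rightarrow> real^('b + 'd)^('a + 'c)" where
  "blk M11 M12 M21 M22 = (\<chi> i j. case i of
      Inl a \<Rightarrow> (case j of Inl b \<Rightarrow> M11 $ a $ b | Inr d \<Rightarrow> M12 $ a $ d)
    | Inr c \<Rightarrow> (case j of Inl b \<Rightarrow> M21 $ c $ b | Inr d \<Rightarrow> M22 $ c $ d))"

definition hcat :: "real^'b^'a \<Rightarrow> real^'d^'a \<Rightarrow> real^('b + 'd)^'a" where
  "hcat M N = (\<chi> i j. case j of Inl b \<Rightarrow> M $ i $ b | Inr d \<Rightarrow> N $ i $ d)"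

definition vcat :: "real^'a \<Rightarrow> real^'b \<Rightarrow> real^('a + 'b)" where
  "vcat u v = (\<chi> i. case i of Inl a \<Rightarrow> u $ a | Inr b \<Rightarrow> v $ b)"

text \<open>Blocks of a 2x2 block matrix T = (T1 T2; T3 T4), numbered as in the paper.\<close>
definition blk1 :: "real^('b::finite + 'd::finite)^('a::finite + 'c::finite) \<Rightarrow> real^'b^'a" where
  "blk1 T = (\<chi> i j. T $ Inl i $ Inl j)"
definition blk2 :: "real^('b::finite + 'd::finite)^('a::finite + 'c::finite) \<Rightarrow> real^'d^'a" where
  "blk2 T = (\<chi> i j. T $ Inl i $ Inr j)"
definition blk3 :: "real^('b::finite + 'd::finite)^('a::finite + 'c::finite) \<Rightarrow> real^'b^'c" where
  "blk3 T = (\<chi> i j. T $ Inr i $ Inl j)"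
definition blk4 :: "real^('b::finite + 'd::finite)^('a::finite + 'c::finite) \<Rightarrow> real^'d^'c" where
  "blk4 T = (\<chi> i j. T $ Inr i $ Inr j)"

section \<open>Matrix (semi)definiteness\<close>

definition sym_mat :: "real^'n^'n \<Rightarrow> bool" where
  "sym_mat M \<longleftrightarrow> transpose M = M"

definition pos_def :: "real^'n^'n \<Rightarrow> bool" where
  "pos_def M \<longleftrightarrow> sym_mat M \<and> (\<forall>v. v \<noteq> 0 \<longrightarrow> 0 < v \<bullet> (M *v v))"

definition neg_def :: "real^'n^'n \<Rightarrow> bool" where
  "neg_def M \<longleftrightarrow> pos_def (- M)"

text \<open>M \<le> 0 (negative semidefinite), for a (symmetric) matrix M.\<close>
definition neg_semidef :: "real^'n^'n \<Rightarrow> bool" where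
  "neg_semidef M \<longleftrightarrow> (\<forall>v. v \<bullet> (M *v v) \<le> 0)"

section \<open>Incremental multiplier matrices\<close>

definition delta_MM :: "(real^'q::finite \<Rightarrow> real^'p::finite) \<Rightarrow> real^('q + 'p)^('q + 'p) \<Rightarrow> bool" where
  "delta_MM p M \<longleftrightarrow> (\<forall>q1 q2. let z = vcat (q2 - q1) (p q2 - p q1) in 0 \<le> z \<bullet> (M *v z))"

definition assumption_A1 ::
  "(real^'q::finite \<Rightarrow> real^'p::finite) \<Rightarrow> ((real^'q^'q) \<times> (real^'p^'p)) set \<Rightarrow> real^('q + 'p)^('q + 'p) \<Rightarrow> bool" where
  "assumption_A1 p N1 T1 \<longleftrightarrow> invertible T1 \<and> invertible (blk4 T1) \<and>
     (\<forall>(X, Y) \<in> N1. sym_mat X \<and> sym_mat Y \<and>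
        delta_MM p (transpose T1 ** blk X 0 0 (- Y) ** T1))"

definition assumption_A2 ::
  "(real^'q::finite \<Rightarrow> real^'p::finite) \<Rightarrow> ((real^'q^'q) \<times> (real^'p^'p)) set \<Rightarrow> real^('q + 'p)^('q + 'p) \<Rightarrow> bool" where
  "assumption_A2 p N2 T2 \<longleftrightarrow> invertible T2 \<and> invertible (blk4 T2) \<and>
     (\<forall>(X, Y) \<in> N2. sym_mat X \<and> sym_mat Y \<and> invertible X \<and> invertible Y \<and>
        delta_MM p (transpose T2 ** blk (matrix_inv X) 0 0 (- matrix_inv Y) ** T2))"

section \<open>Derived matrices\<close>

definition Atil :: "real^'x::finite^'x \<Rightarrow> real^'p::finite^'x \<Rightarrow> real^'x^'q::finite \<Rightarrow> real^('q + 'p)^('q + 'p) \<Rightarrow> real^'x^'x" where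
  "Atil A E Cq T = A - E ** matrix_inv (blk4 T) ** blk3 T ** Cq"

definition Etil :: "real^'p::finite^'x::finite \<Rightarrow> real^('q::finite + 'p)^('q + 'p) \<Rightarrow> real^'p^'x" where
  "Etil E T = E ** matrix_inv (blk4 T)"

definition Gam1 :: "real^('q::finite + 'p::finite)^('q + 'p) \<Rightarrow> real^'q^'q" where
  "Gam1 T = blk1 T - blk2 T ** matrix_inv (blk4 T) ** blk3 T"

definition Gam2 :: "real^('q::finite + 'p::finite)^('q + 'p) \<Rightarrow> real^'p^'q" where
  "Gam2 T = blk2 T ** matrix_inv (blk4 T)"

text \<open>The selector varphi = (0, I, 0).\<close>
definition varphi :: "real^('x::finite + ('p::finite + 'w::finite))^'p" where
  "varphi = hcat (0 :: real^'x^'p) (hcat (mat 1 :: real^'p^'p) (0 :: real^'w^'p))"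

text \<open>First LMI (observer design).\<close>
definition LMI1 ::
  "real^'x::finite^'x \<Rightarrow> real^'p::finite^'x \<Rightarrow> real^'w::finite^'x \<Rightarrow> real^'x^'y::finite \<Rightarrow> real^'w^'y \<Rightarrow> real^'x^'q::finite \<Rightarrow>
   real^('q + 'p)^('q + 'p) \<Rightarrow> real \<Rightarrow> real \<Rightarrow> real^'x^'x \<Rightarrow> real^'y^'x \<Rightarrow> real^'y^'q \<Rightarrow>
   real^'q^'q \<Rightarrow> real^'p^'p \<Rightarrow> real^(('x + ('p + 'w)) + 'q)^(('x + ('p + 'w)) + 'q)" where
  "LMI1 A E Ew C Fw Cq T1 \<alpha>1 \<mu>1 P1 R1 R2 X1 Y1 =
    (let At = Atil A E Cq T1; Et = Etil E T1;
         Phi0 = transpose At ** P1 + P1 ** At + transpose C ** transpose R1 + R1 ** C + \<alpha>1 *\<^sub>R P1;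
         Row = hcat (- (P1 ** Et)) (P1 ** Ew + R1 ** Fw);
         Phi = blk Phi0 Row (transpose Row) (blk (0 :: real^'p^'p) 0 0 (- (\<mu>1 *\<^sub>R mat 1)));
         phi = hcat (- (X1 ** Gam1 T1 ** Cq + R2 ** C)) (hcat (X1 ** Gam2 T1) (- (R2 ** Fw)))
     in blk (Phi - transpose varphi ** Y1 ** varphi) (transpose phi) phi (- X1))"

text \<open>Second LMI (controller design).\<close>
definition LMI2 ::
  "real^'x::finite^'x \<Rightarrow> real^'u::finite^'x \<Rightarrow> real^'p::finite^'x \<Rightarrow> real^'w::finite^'x \<Rightarrow> real^'x^'q::finite \<Rightarrow>
   real^('q + 'p)^('q + 'p) \<Rightarrow> real \<Rightarrow> real \<Rightarrow> real^'x^'x \<Rightarrow> real^'x^'u \<Rightarrow> real^'p^'u \<Rightarrow>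
   real^'q^'q \<Rightarrow> real^'p^'p \<Rightarrow> real^(('x + ('p + 'w)) + 'q)^(('x + ('p + 'w)) + 'q)" where
  "LMI2 A B E Ew Cq T2 \<alpha>2 \<mu>2 P2 R3 R4 X2 Y2 =
    (let At = Atil A E Cq T2; Et = Etil E T2;
         Psi0 = At ** P2 + P2 ** transpose At + B ** R3 + transpose R3 ** transpose B + \<alpha>2 *\<^sub>R P2;
         Row = hcat (Et ** Y2 + B ** R4) Ew;
         Psi = blk Psi0 Row (transpose Row) (blk (0 :: real^'p^'p) 0 0 (- (\<mu>2 *\<^sub>R mat 1)));
         psi = hcat (Gam1 T2 ** Cq ** P2) (hcat (Gam2 T2 ** Y2) (0 :: real^'w^'q))
     in blk (Psi - transpose varphi ** Y2 ** varphi) (transpose psi) psi (- X2))"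

section \<open>Comparison functions and ISS\<close>

definition class_K :: "(real \<Rightarrow> real) \<Rightarrow> bool" where
  "class_K \<gamma> \<longleftrightarrow> continuous_on {0..} \<gamma> \<and> \<gamma> 0 = 0 \<and> strict_mono_on {0..} \<gamma>"

definition class_KL :: "(real \<Rightarrow> real \<Rightarrow> real) \<Rightarrow> bool" where
  "class_KL \<beta> \<longleftrightarrow> continuous_on ({0..} \<times> {0..}) (\<lambda>(r, t). \<beta> r t) \<and>
     (\<forall>t \<ge> 0. class_K (\<lambda>r. \<beta> r t)) \<and>
     (\<forall>r \<ge> 0. (\<forall>s t. 0 \<le> s \<longrightarrow> s \<le> t \<longrightarrow> \<beta> r t \<le> \<beta> r s) \<and> (\<beta> r \<longlongrightarrow> 0) at_top)"

text \<open>Solutions of the closed loop in the (x, e) coordinates on [0, \<infinity>), in integral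
  (Caratheodory) sense, driven by the disturbance w.\<close>
definition closed_loop_sol ::
  "real^'x::finite^'x \<Rightarrow> real^'u::finite^'x \<Rightarrow> real^'p::finite^'x \<Rightarrow> real^'w::finite^'x \<Rightarrow> real^'x^'y::finite \<Rightarrow> real^'w^'y \<Rightarrow> real^'x^'q::finite \<Rightarrow>
   (real^'q \<Rightarrow> real^'p) \<Rightarrow> real^'x^'u \<Rightarrow> real^'p^'u \<Rightarrow> real^'y^'q \<Rightarrow> real^'y^'x \<Rightarrow>
   (real \<Rightarrow> real^'w) \<Rightarrow> (real \<Rightarrow> real^'x) \<Rightarrow> (real \<Rightarrow> real^'x) \<Rightarrow> bool" where
  "closed_loop_sol A B E Ew C Fw Cq p K1 K2 L1 L2 w x e \<longleftrightarrow>
    (let q = (\<lambda>s. Cq *v x s);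
         dk = (\<lambda>s. K1 *v e s - K2 *v (p (Cq *v (x s - e s)) - p (q s)));
         dq = (\<lambda>s. - ((Cq + L1 ** C) *v e s) - L1 *v (Fw *v w s));
         dp = (\<lambda>s. p (q s + dq s) - p (q s));
         fx = (\<lambda>s. (A + B ** K1) *v x s + (E + B ** K2) *v p (q s) - B *v dk s + Ew *v w s);
         fe = (\<lambda>s. (A + L2 ** C) *v e s - E *v dp s + (Ew + L2 ** Fw) *v w s)
     in \<forall>t \<ge> 0. (fx has_integral (x t - x 0)) {0..t} \<and> (fe has_integral (e t - e 0)) {0..t})"

text \<open>ISS w.r.t. w: one KL-function and one K-function bound every solution defined on
  [0, \<infinity>) for every bounded disturbance; the norm of (x, e) is the Euclidean norm.\<close>
definition ISS_wrt ::
  "((real \<Rightarrow> real^'w::finite) \<Rightarrow> (real \<Rightarrow> real^'x::finite) \<Rightarrow> (real \<Rightarrow> real^'x) \<Rightarrow> bool) \<Rightarrow> bool" where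
  "ISS_wrt sol \<longleftrightarrow> (\<exists>\<beta> \<gamma>. class_KL \<beta> \<and> class_K \<gamma> \<and>
     (\<forall>w x e. bounded (w ` {0..}) \<and> sol w x e \<longrightarrow>
        (\<forall>t \<ge> 0. norm (x t, e t) \<le> \<beta> (norm (x 0, e 0)) t + \<gamma> (SUP s\<in>{0..}. norm (w s)))))"

end

theory Submission
  imports Defs
begin

text \<open>Completing the square with the incremental multiplier of Assumption A1 turns the first LMI
  into the dissipation inequality 2 e' P1 (de/dt) \<le> \<mu>1 |w|^2 - \<alpha>1 e' P1 e for the estimation
  error; with the multiplier of Assumption A2 the second LMI gives the analogous inequality for
  x' inv(P2) x along the state dynamics under the ideal feedback K1 x + K2 p(Cq x). Because M24 < 0,
  the multiplier M2 bounds |\<delta>p| by a multiple of |\<delta>q|, so p is globally Lipschitz and the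
  mismatch \<Delta>k between the actual and the ideal feedback is linear in e. The cross term it creates
  is absorbed by W = x' inv(P2) x + \<kappa> e' P1 e for a large weight \<kappa>, so W decays exponentially
  up to a multiple of the squared sup norm of w. Since solutions are only given in integral form,
  this decay estimate is derived from an Euler discretisation of the integral equation.\<close>

lemma sum_UNIV_Plus:
  "sum f (UNIV :: ('a::finite + 'b::finite) set) = sum (\<lambda>a. f (Inl a)) UNIV + sum (\<lambda>b. f (Inr b)) UNIV"
  using sum.Plus[of "UNIV :: 'a set" "UNIV :: 'b set" f] by (simp add: o_def)

lemma blk_mult_vcat:
  "blk M11 M12 M21 M22 *v vcat a c = vcat (M11 *v a + M12 *v c) (M21 *v a + M22 *v c)"
  by (auto simp: vec_eq_iff blk_def vcat_def matrix_vector_mult_def sum_UNIV_Plus split: sum.splits)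

lemma hcat_mult_vcat: "hcat M N *v vcat a c = M *v a + N *v c"
  by (auto simp: vec_eq_iff hcat_def vcat_def matrix_vector_mult_def sum_UNIV_Plus)

lemma inner_vcat: "vcat a b \<bullet> vcat c d = a \<bullet> c + b \<bullet> d"
  by (simp add: inner_vec_def vcat_def sum_UNIV_Plus)

lemma blk_blocks: "blk (blk1 T) (blk2 T) (blk3 T) (blk4 T) = T"
  by (auto simp: vec_eq_iff blk_def blk1_def blk2_def blk3_def blk4_def split: sum.splits)

lemma matrix_vector_mult_vcat_blocks: "T *v vcat a c = vcat (blk1 T *v a + blk2 T *v c) (blk3 T *v a + blk4 T *v c)"
  by (metis blk_blocks blk_mult_vcat)

lemma vcat_eq_0_iff: "vcat a b = 0 \<longleftrightarrow> a = 0 \<and> b = 0"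
  by (auto simp: vec_eq_iff vcat_def split: sum.splits)

lemma matrix_vector_mult_uminus_left: "(- M) *v (x::real^'n) = - (M *v x)"
  by (simp add: vec_eq_iff matrix_vector_mult_def sum_negf)

lemma matrix_vector_mult_uminus_right: "M *v (- (x::real^'n)) = - (M *v x)"
  by (simp add: vec_eq_iff matrix_vector_mult_def sum_negf)

lemma scaleR_matrix_vector_mult: "(c *\<^sub>R M) *v (x::real^'n) = c *\<^sub>R (M *v x)"
  by (simp add: vec_eq_iff matrix_vector_mult_def sum_distrib_left mult.assoc)

lemmas matrix_vector_mult_simps = matrix_vector_mul_assoc[symmetric]
  matrix_vector_mult_add_rdistrib matrix_vector_mult_diff_rdistrib
  matrix_vector_right_distrib matrix_vector_mult_diff_distrib matrix_vector_mult_scaleR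
  matrix_vector_mult_uminus_left matrix_vector_mult_uminus_right scaleR_matrix_vector_mult

lemma inner_transpose_mult: "(x::real^'n) \<bullet> (transpose M *v y) = (M *v x) \<bullet> y"
  by (metis dot_lmul_matrix inner_commute transpose_matrix_vector)

lemma inner_vector_matrix_mult: "(x::real^'n) \<bullet> (y v* M) = (M *v x) \<bullet> y"
  by (metis inner_transpose_mult transpose_matrix_vector)

lemma sym_mat_inner: "sym_mat M \<Longrightarrow> (x::real^'n) \<bullet> (M *v y) = (M *v x) \<bullet> y"
  by (metis inner_transpose_mult sym_mat_def)

lemma matrix_inv_inverse:
  assumes "invertible M"
  shows "M ** matrix_inv M = mat 1" "matrix_inv M ** M = mat 1"
  using someI_ex[OF assms[unfolded invertible_def]] by (simp_all add: matrix_inv_def)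

lemma matrix_inv_mult_vector:
  assumes "invertible M"
  shows "M *v (matrix_inv M *v v) = v" "matrix_inv M *v (M *v v) = v"
  by (simp_all add: matrix_vector_mul_assoc matrix_inv_inverse[OF assms])

lemma invertible_of_kernel_trivial:
  fixes M :: "real^'n^'n"
  assumes "\<And>v. M *v v = 0 \<Longrightarrow> v = 0"
  shows "invertible M"
  using assms invertible_left_inverse matrix_left_invertible_ker by blast

lemma pos_def_invertible: "pos_def (M::real^'n^'n) \<Longrightarrow> invertible M"
  by (rule invertible_of_kernel_trivial) (metis inner_zero_right less_irrefl pos_def_def)

lemma sym_mat_matrix_inv:
  assumes "sym_mat M" "invertible M"
  shows "sym_mat (matrix_inv M)"
proof -
  have "transpose (matrix_inv M) ** M = mat 1"
    by (metis assms matrix_inv_inverse(1) matrix_transpose_mul sym_mat_def transpose_mat)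
  then have "transpose (matrix_inv M) = matrix_inv M"
    by (metis assms(2) matrix_inv_inverse(1) matrix_mul_assoc matrix_mul_lid matrix_mul_rid)
  then show ?thesis by (simp add: sym_mat_def)
qed

lemma pos_def_matrix_inv:
  assumes "pos_def P"
  shows "pos_def (matrix_inv P)"
  unfolding pos_def_def
proof (intro conjI allI impI)
  have P: "invertible P" using assms by (rule pos_def_invertible)
  show "sym_mat (matrix_inv P)" using sym_mat_matrix_inv[OF _ P] assms by (simp add: pos_def_def)
  fix v :: "real^'a" assume "v \<noteq> 0"
  then have "matrix_inv P *v v \<noteq> 0" by (metis P matrix_inv_mult_vector(1) matrix_vector_mult_0_right)
  then have "0 < (matrix_inv P *v v) \<bullet> (P *v (matrix_inv P *v v))" using assms by (simp add: pos_def_def)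
  then show "0 < v \<bullet> (matrix_inv P *v v)" by (simp add: matrix_inv_mult_vector[OF P] inner_commute)
qed

text \<open>Gam1 and Gam2 come from eliminating the second block row of T (a Schur complement).\<close>
lemma blk1_blk2_eq_Gam:
  assumes "invertible (blk4 T)"
  shows "blk1 T *v q + blk2 T *v r = Gam1 T *v q + Gam2 T *v (blk3 T *v q + blk4 T *v r)"
  by (simp add: Gam1_def Gam2_def matrix_vector_mult_simps matrix_inv_mult_vector[OF assms])

lemma invertible_Gam1:
  fixes T :: "real^('q::finite + 'p::finite)^('q + 'p)"
  assumes "invertible T" "invertible (blk4 T)"
  shows "invertible (Gam1 T)"
proof (rule invertible_of_kernel_trivial)
  fix v assume v: "Gam1 T *v v = 0"
  define c where "c = - (matrix_inv (blk4 T) *v (blk3 T *v v))"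
  have "T *v vcat v c = vcat (Gam1 T *v v) 0"
    using assms(2) by (simp add: matrix_vector_mult_vcat_blocks c_def Gam1_def matrix_vector_mult_simps matrix_inv_mult_vector)
  then have "T *v vcat v c = 0" using v by (simp add: vcat_eq_0_iff)
  then have "vcat v c = 0"
    by (metis assms(1) injD inj_matrix_vector_mult matrix_vector_mult_0_right)
  then show "v = 0" by (simp add: vcat_eq_0_iff)
qed

lemma delta_MM_transformed:
  fixes q1 q2 :: "real^'q::finite" and p :: "real^'q \<Rightarrow> real^'p::finite"
  assumes "delta_MM p (transpose T ** blk X 0 0 (- Y) ** T)"
  defines "a \<equiv> blk1 T *v (q2 - q1) + blk2 T *v (p q2 - p q1)"
    and "b \<equiv> blk3 T *v (q2 - q1) + blk4 T *v (p q2 - p q1)"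
  shows "b \<bullet> (Y *v b) \<le> a \<bullet> (X *v a)"
proof -
  have "0 \<le> vcat (q2 - q1) (p q2 - p q1) \<bullet> ((transpose T ** blk X 0 0 (- Y) ** T) *v vcat (q2 - q1) (p q2 - p q1))"
    using assms unfolding delta_MM_def Let_def by blast
  also have "\<dots> = (T *v vcat (q2 - q1) (p q2 - p q1)) \<bullet> (blk X 0 0 (- Y) *v (T *v vcat (q2 - q1) (p q2 - p q1)))"
    by (simp only: matrix_vector_mul_assoc[symmetric] inner_transpose_mult)
  also have "T *v vcat (q2 - q1) (p q2 - p q1) = vcat a b"
    by (simp add: matrix_vector_mult_vcat_blocks a_def b_def)
  finally show ?thesis by (simp add: blk_mult_vcat inner_vcat matrix_vector_mult_uminus_left)
qed

lemma quadratic_form_lower_bound: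
  fixes H :: "'a::euclidean_space \<Rightarrow> 'a"
  assumes "bounded_linear H" and pos: "\<And>v. v \<noteq> 0 \<Longrightarrow> 0 < v \<bullet> H v"
  obtains c where "0 < c" "\<And>v. c * (norm v)\<^sup>2 \<le> v \<bullet> H v"
proof -
  have "continuous_on (sphere 0 1) (\<lambda>v. v \<bullet> H v)"
    using assms(1) by (intro continuous_intros linear_continuous_on)
  moreover have "sphere (0::'a) 1 \<noteq> {}" by simp
  ultimately obtain v0 where v0: "v0 \<in> sphere 0 1" and min: "\<And>v. v \<in> sphere 0 1 \<Longrightarrow> v0 \<bullet> H v0 \<le> v \<bullet> H v"
    using continuous_attains_inf[OF compact_sphere] by blast
  have "c * (norm v)\<^sup>2 \<le> v \<bullet> H v" if "c = v0 \<bullet> H v0" for c v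
  proof (cases "v = 0")
    case False
    have "v /\<^sub>R norm v \<in> sphere 0 1" using False by simp
    then have "c \<le> (v /\<^sub>R norm v) \<bullet> H (v /\<^sub>R norm v)" using min that by blast
    also have "\<dots> = (v \<bullet> H v) / (norm v)\<^sup>2"
      using bounded_linear.linear[OF assms(1)] by (simp add: linear_scale power2_eq_square divide_inverse)
    finally show ?thesis using False by (simp add: field_simps)
  qed simp
  moreover have "0 < v0 \<bullet> H v0" using v0 pos by (metis mem_sphere_0 norm_zero zero_neq_one)
  ultimately show thesis using that by blast
qed

lemma quadratic_form_upper_bound:
  assumes "bounded_linear H"
  shows "v \<bullet> H v \<le> onorm H * (norm v)\<^sup>2"
proof -
  have "v \<bullet> H v \<le> norm v * norm (H v)" by (rule norm_cauchy_schwarz)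
  also have "\<dots> \<le> norm v * (onorm H * norm v)" by (intro mult_left_mono onorm assms) simp
  finally show ?thesis by (simp add: power2_eq_square mult_ac)
qed

lemma inner_matrix_vector_le: "(x::real^'n::finite) \<bullet> (M *v y) \<le> onorm ((*v) M) * norm x * norm y"
proof -
  have "x \<bullet> (M *v y) \<le> norm x * norm (M *v y)" by (rule norm_cauchy_schwarz)
  also have "\<dots> \<le> norm x * (onorm ((*v) M) * norm y)" by (intro mult_left_mono onorm) auto
  finally show ?thesis by (simp add: mult_ac)
qed

lemma inner_LMI_block:
  fixes Phi :: "real^'n::finite^'n" and S :: "real^'n^'k::finite" and Psi :: "real^'n^'m::finite"
  shows "vcat V u \<bullet> (blk (Phi - transpose S ** Y ** S) (transpose Psi) Psi (- X) *v vcat V u)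
       = V \<bullet> (Phi *v V) - (S *v V) \<bullet> (Y *v (S *v V)) + 2 * ((Psi *v V) \<bullet> u) - u \<bullet> (X *v u)"
  unfolding blk_mult_vcat inner_vcat
  by (simp add: matrix_vector_mult_diff_rdistrib matrix_vector_mult_uminus_left inner_add_right
      inner_diff_right matrix_vector_mul_assoc[symmetric] inner_vector_matrix_mult inner_commute[of u])

lemma inner_bordered_block:
  "vcat z (vcat s w) \<bullet> (blk Phi0 Row (transpose Row) (blk (0 :: real^'p::finite^'p) 0 0 (- (\<mu> *\<^sub>R mat 1))) *v vcat z (vcat s w))
     = z \<bullet> (Phi0 *v z) + 2 * (z \<bullet> (Row *v vcat s w)) - \<mu> * (w \<bullet> w)"
  by (simp add: blk_mult_vcat inner_vcat inner_add_right inner_transpose_mult inner_commute[of _ z]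
      matrix_vector_mult_uminus_left scaleR_matrix_vector_mult del: transpose_matrix_vector)

lemma inner_transpose_mult_mult: "(x::real^'n) \<bullet> ((transpose M ** N) *v x) = (M *v x) \<bullet> (N *v x)"
  by (simp add: matrix_vector_mul_assoc[symmetric] inner_transpose_mult del: transpose_matrix_vector)

lemma inner_LMI1:
  fixes T1 :: "real^('q::finite + 'p::finite)^('q + 'p)" and e :: "real^'x::finite"
    and w :: "real^'w::finite" and C :: "real^'x^'y::finite"
  assumes "sym_mat P1"
  shows "vcat (vcat e (vcat b w)) a \<bullet> (LMI1 A E Ew C Fw Cq T1 \<alpha>1 \<mu>1 P1 R1 R2 X1 Y1 *v vcat (vcat e (vcat b w)) a)
    = 2 * (e \<bullet> (P1 *v (Atil A E Cq T1 *v e - Etil E T1 *v b + Ew *v w) + R1 *v (C *v e + Fw *v w)))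
      + \<alpha>1 * (e \<bullet> (P1 *v e)) - \<mu>1 * (w \<bullet> w) - b \<bullet> (Y1 *v b)
      + 2 * ((X1 *v (Gam2 T1 *v b - Gam1 T1 *v (Cq *v e)) - R2 *v (C *v e + Fw *v w)) \<bullet> a) - a \<bullet> (X1 *v a)"
proof -
  define At where "At = Atil A E Cq T1"
  define Et where "Et = Etil E T1"
  define Phi0 where "Phi0 = transpose At ** P1 + P1 ** At + transpose C ** transpose R1 + R1 ** C + \<alpha>1 *\<^sub>R P1"
  define Row where "Row = hcat (- (P1 ** Et)) (P1 ** Ew + R1 ** Fw)"
  define phi where "phi = hcat (- (X1 ** Gam1 T1 ** Cq + R2 ** C)) (hcat (X1 ** Gam2 T1) (- (R2 ** Fw)))"
  have LMI: "LMI1 A E Ew C Fw Cq T1 \<alpha>1 \<mu>1 P1 R1 R2 X1 Y1 = blk (blk Phi0 Row (transpose Row)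
      (blk (0 :: real^'p^'p) 0 0 (- (\<mu>1 *\<^sub>R mat 1))) - transpose varphi ** Y1 ** varphi) (transpose phi) phi (- X1)"
    by (simp add: LMI1_def Let_def phi_def Phi0_def Row_def At_def Et_def)
  have "(varphi :: real^('x + ('p + 'w))^'p) *v vcat e (vcat b w) = b"
    by (simp add: varphi_def hcat_mult_vcat)
  moreover have "phi *v vcat e (vcat b w) = X1 *v (Gam2 T1 *v b - Gam1 T1 *v (Cq *v e)) - R2 *v (C *v e + Fw *v w)"
    by (simp add: phi_def hcat_mult_vcat matrix_vector_mult_simps)
  moreover have "e \<bullet> (Phi0 *v e) + 2 * (e \<bullet> (Row *v vcat b w))
      = 2 * (e \<bullet> (P1 *v (At *v e - Et *v b + Ew *v w) + R1 *v (C *v e + Fw *v w))) + \<alpha>1 * (e \<bullet> (P1 *v e))"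
    using sym_mat_inner[OF assms, of e]
    by (simp add: Phi0_def Row_def hcat_mult_vcat inner_transpose_mult_mult matrix_vector_mult_simps
        inner_add_right inner_diff_right inner_transpose_mult inner_commute[of "R1 *v z" for z]
        inner_commute[of "At *v e"] del: transpose_matrix_vector)
  ultimately show ?thesis
    unfolding LMI inner_LMI_block inner_bordered_block At_def Et_def by simp
qed

lemma inner_LMI2:
  fixes T2 :: "real^('q::finite + 'p::finite)^('q + 'p)" and z :: "real^'x::finite"
    and w :: "real^'w::finite" and B :: "real^'u::finite^'x"
  assumes "sym_mat P2"
  shows "vcat (vcat z (vcat s w)) u \<bullet> (LMI2 A B E Ew Cq T2 \<alpha>2 \<mu>2 P2 R3 R4 X2 Y2 *v vcat (vcat z (vcat s w)) u)
    = 2 * (z \<bullet> (Atil A E Cq T2 *v (P2 *v z) + B *v (R3 *v z) + Etil E T2 *v (Y2 *v s) + B *v (R4 *v s) + Ew *v w))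
      + \<alpha>2 * (z \<bullet> (P2 *v z)) - \<mu>2 * (w \<bullet> w) - s \<bullet> (Y2 *v s)
      + 2 * ((Gam1 T2 *v (Cq *v (P2 *v z)) + Gam2 T2 *v (Y2 *v s)) \<bullet> u) - u \<bullet> (X2 *v u)"
proof -
  define At where "At = Atil A E Cq T2"
  define Et where "Et = Etil E T2"
  define Psi0 where "Psi0 = At ** P2 + P2 ** transpose At + B ** R3 + transpose R3 ** transpose B + \<alpha>2 *\<^sub>R P2"
  define Row where "Row = hcat (Et ** Y2 + B ** R4) Ew"
  define psi where "psi = hcat (Gam1 T2 ** Cq ** P2) (hcat (Gam2 T2 ** Y2) (0 :: real^'w^'q))"
  have LMI: "LMI2 A B E Ew Cq T2 \<alpha>2 \<mu>2 P2 R3 R4 X2 Y2 = blk (blk Psi0 Row (transpose Row)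
      (blk (0 :: real^'p^'p) 0 0 (- (\<mu>2 *\<^sub>R mat 1))) - transpose varphi ** Y2 ** varphi) (transpose psi) psi (- X2)"
    by (simp add: LMI2_def Let_def psi_def Psi0_def Row_def At_def Et_def)
  have "(varphi :: real^('x + ('p + 'w))^'p) *v vcat z (vcat s w) = s"
    by (simp add: varphi_def hcat_mult_vcat)
  moreover have "psi *v vcat z (vcat s w) = Gam1 T2 *v (Cq *v (P2 *v z)) + Gam2 T2 *v (Y2 *v s)"
    by (simp add: psi_def hcat_mult_vcat matrix_vector_mult_simps)
  moreover have "z \<bullet> (Psi0 *v z) + 2 * (z \<bullet> (Row *v vcat s w))
      = 2 * (z \<bullet> (At *v (P2 *v z) + B *v (R3 *v z) + Et *v (Y2 *v s) + B *v (R4 *v s) + Ew *v w))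
        + \<alpha>2 * (z \<bullet> (P2 *v z))"
  proof -
    have "z \<bullet> (P2 *v (transpose At *v z)) = z \<bullet> (At *v (P2 *v z))"
      by (metis assms inner_commute inner_transpose_mult sym_mat_inner)
    moreover have "z \<bullet> (transpose R3 *v (transpose B *v z)) = z \<bullet> (B *v (R3 *v z))"
      by (metis inner_commute inner_transpose_mult)
    ultimately show ?thesis
      by (simp add: Psi0_def Row_def hcat_mult_vcat matrix_vector_mult_simps inner_add_right
          del: transpose_matrix_vector)
  qed
  ultimately show ?thesis
    unfolding LMI inner_LMI_block inner_bordered_block At_def Et_def by simp
qed

text \<open>The closed loop in the coordinates (x, e) splits into the state dynamics under the ideal
  feedback K1 x + K2 p(Cq x), the mismatch \<Delta>k of the paper, and the estimation-error dynamics.\<close>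
definition state_field ::
  "real^'x::finite^'x \<Rightarrow> real^'u::finite^'x \<Rightarrow> real^'p::finite^'x \<Rightarrow> real^'w::finite^'x \<Rightarrow> real^'x^'q::finite \<Rightarrow>
   (real^'q \<Rightarrow> real^'p) \<Rightarrow> real^'x^'u \<Rightarrow> real^'p^'u \<Rightarrow> real^'x \<Rightarrow> real^'w \<Rightarrow> real^'x" where
  "state_field A B E Ew Cq p K1 K2 x w = (A + B ** K1) *v x + (E + B ** K2) *v p (Cq *v x) + Ew *v w"

definition feedback_mismatch ::
  "real^'x::finite^'q::finite \<Rightarrow> (real^'q \<Rightarrow> real^'p::finite) \<Rightarrow> real^'x^'u::finite \<Rightarrow> real^'p^'u \<Rightarrow>
   real^'x \<Rightarrow> real^'x \<Rightarrow> real^'u" where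
  "feedback_mismatch Cq p K1 K2 x e = K1 *v e - K2 *v (p (Cq *v (x - e)) - p (Cq *v x))"

definition estimation_error_field ::
  "real^'x::finite^'x \<Rightarrow> real^'p::finite^'x \<Rightarrow> real^'w::finite^'x \<Rightarrow> real^'x^'y::finite \<Rightarrow> real^'w^'y \<Rightarrow>
   real^'x^'q::finite \<Rightarrow> (real^'q \<Rightarrow> real^'p) \<Rightarrow> real^'y^'q \<Rightarrow> real^'y^'x \<Rightarrow>
   real^'x \<Rightarrow> real^'x \<Rightarrow> real^'w \<Rightarrow> real^'x" where
  "estimation_error_field A E Ew C Fw Cq p L1 L2 x e w =
     (A + L2 ** C) *v e - E *v (p (Cq *v x + (- ((Cq + L1 ** C) *v e) - L1 *v (Fw *v w))) - p (Cq *v x))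
     + (Ew + L2 ** Fw) *v w"

lemma observer_dissipation:
  fixes T1 :: "real^('q::finite + 'p::finite)^('q + 'p)" and e :: "real^'x::finite" and w :: "real^'w::finite"
  assumes A1: "assumption_A1 p N1 T1" and N1: "(X1, Y1) \<in> N1"
    and P1: "pos_def P1" and X1: "pos_def X1"
    and LMI1: "neg_semidef (LMI1 A E Ew C Fw Cq T1 \<alpha>1 \<mu>1 P1 R1 R2 X1 Y1)"
    and L1: "L1 = matrix_inv (Gam1 T1) ** matrix_inv X1 ** R2"
    and L2: "L2 = matrix_inv P1 ** R1 + E ** matrix_inv (blk4 T1) ** blk3 T1 ** L1"
  shows "2 * ((P1 *v e) \<bullet> estimation_error_field A E Ew C Fw Cq p L1 L2 x e w)
           \<le> \<mu>1 * (norm w)\<^sup>2 - \<alpha>1 * (e \<bullet> (P1 *v e))"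
proof -
  have T4: "invertible (blk4 T1)" and X1s: "sym_mat X1"
    and MM: "delta_MM p (transpose T1 ** blk X1 0 0 (- Y1) ** T1)"
    and G1: "invertible (Gam1 T1)"
    using A1 N1 invertible_Gam1[of T1] by (auto simp: assumption_A1_def)
  have P1i: "invertible P1" and X1i: "invertible X1" and P1s: "sym_mat P1"
    using P1 X1 by (auto simp: pos_def_invertible pos_def_def)
  define dq where "dq = - ((Cq + L1 ** C) *v e) - L1 *v (Fw *v w)"
  define dp where "dp = p (Cq *v x + dq) - p (Cq *v x)"
  define a where "a = blk1 T1 *v dq + blk2 T1 *v dp"
  define b where "b = blk3 T1 *v dq + blk4 T1 *v dp"
  have sector: "b \<bullet> (Y1 *v b) \<le> a \<bullet> (X1 *v a)"
    using delta_MM_transformed[OF MM, of "Cq *v x + dq" "Cq *v x"] by (simp add: a_def b_def dp_def)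
  \<comment> \<open>the choice of L1 makes the multiplier term of the LMI reproduce X1 a\<close>
  have "X1 *v (Gam1 T1 *v (L1 *v v)) = R2 *v v" for v
    by (simp add: L1 matrix_vector_mult_simps matrix_inv_mult_vector[OF G1] matrix_inv_mult_vector[OF X1i])
  moreover have "a = Gam1 T1 *v dq + Gam2 T1 *v b"
    by (simp add: a_def b_def blk1_blk2_eq_Gam[OF T4])
  ultimately have mult: "X1 *v (Gam2 T1 *v b - Gam1 T1 *v (Cq *v e)) - R2 *v (C *v e + Fw *v w) = X1 *v a"
    by (simp add: dq_def matrix_vector_mult_simps)
  have field: "P1 *v (Atil A E Cq T1 *v e - Etil E T1 *v b + Ew *v w) + R1 *v (C *v e + Fw *v w)
      = P1 *v estimation_error_field A E Ew C Fw Cq p L1 L2 x e w"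
    by (simp add: estimation_error_field_def L2 Atil_def Etil_def b_def dq_def dp_def matrix_vector_mult_simps
        matrix_inv_mult_vector[OF P1i] matrix_inv_mult_vector[OF T4])
  have "vcat (vcat e (vcat b w)) a \<bullet> (LMI1 A E Ew C Fw Cq T1 \<alpha>1 \<mu>1 P1 R1 R2 X1 Y1 *v vcat (vcat e (vcat b w)) a) \<le> 0"
    using LMI1 by (simp add: neg_semidef_def)
  then show ?thesis
    using sector sym_mat_inner[OF X1s, of a a] sym_mat_inner[OF P1s, of e]
    unfolding inner_LMI1[OF P1s] mult field by (simp add: dot_square_norm)
qed

lemma state_feedback_dissipation:
  fixes T2 :: "real^('q::finite + 'p::finite)^('q + 'p)" and x :: "real^'x::finite" and w :: "real^'w::finite"
  assumes p0: "p 0 = 0" and A2: "assumption_A2 p N2 T2" and N2: "(X2, Y2) \<in> N2"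
    and P2: "pos_def P2" and X2: "pos_def X2" and Y2: "pos_def Y2"
    and LMI2: "neg_semidef (LMI2 A B E Ew Cq T2 \<alpha>2 \<mu>2 P2 R3 R4 X2 Y2)"
    and K1: "K1 = R3 ** matrix_inv P2 + K2 ** matrix_inv (blk4 T2) ** blk3 T2 ** Cq"
    and K2: "K2 = R4 ** matrix_inv Y2 ** blk4 T2"
  shows "2 * ((matrix_inv P2 *v x) \<bullet> state_field A B E Ew Cq p K1 K2 x w)
           \<le> \<mu>2 * (norm w)\<^sup>2 - \<alpha>2 * (x \<bullet> (matrix_inv P2 *v x))"
proof -
  have T4: "invertible (blk4 T2)"
    and MM: "delta_MM p (transpose T2 ** blk (matrix_inv X2) 0 0 (- matrix_inv Y2) ** T2)"
    using A2 N2 by (auto simp: assumption_A2_def)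
  have P2i: "invertible P2" and X2i: "invertible X2" and Y2i: "invertible Y2" and P2s: "sym_mat P2"
    using P2 X2 Y2 by (auto simp: pos_def_invertible pos_def_def)
  have X2s: "sym_mat (matrix_inv X2)" using pos_def_matrix_inv[OF X2] by (simp add: pos_def_def)
  define a where "a = blk1 T2 *v (Cq *v x) + blk2 T2 *v p (Cq *v x)"
  define b where "b = blk3 T2 *v (Cq *v x) + blk4 T2 *v p (Cq *v x)"
  define z where "z = matrix_inv P2 *v x"
  define s where "s = matrix_inv Y2 *v b"
  define u where "u = matrix_inv X2 *v a"
  have sector: "b \<bullet> (matrix_inv Y2 *v b) \<le> a \<bullet> (matrix_inv X2 *v a)"
    using delta_MM_transformed[OF MM, of "Cq *v x" 0] by (simp add: a_def b_def p0)
  have x: "P2 *v z = x" and b: "Y2 *v s = b" and a: "X2 *v u = a"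
    by (simp_all add: z_def s_def u_def matrix_inv_mult_vector P2i X2i Y2i)
  have mult: "Gam1 T2 *v (Cq *v (P2 *v z)) + Gam2 T2 *v (Y2 *v s) = a"
    by (simp add: x b a_def b_def blk1_blk2_eq_Gam[OF T4])
  \<comment> \<open>the gains K1, K2 are exactly what turns the LMI field into the closed-loop field\<close>
  have field: "Atil A E Cq T2 *v (P2 *v z) + B *v (R3 *v z) + Etil E T2 *v (Y2 *v s) + B *v (R4 *v s) + Ew *v w
      = state_field A B E Ew Cq p K1 K2 x w"
    unfolding x b
    by (simp add: state_field_def K1 K2 Atil_def Etil_def s_def z_def b_def matrix_vector_mult_simps
        matrix_inv_mult_vector[OF T4] matrix_inv_mult_vector[OF Y2i] add_ac)
  have "vcat (vcat z (vcat s w)) u \<bullet> (LMI2 A B E Ew Cq T2 \<alpha>2 \<mu>2 P2 R3 R4 X2 Y2 *v vcat (vcat z (vcat s w)) u) \<le> 0"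
    using LMI2 by (simp add: neg_semidef_def)
  then show ?thesis
    using sector unfolding inner_LMI2[OF P2s] mult field
    by (simp add: x b dot_square_norm z_def s_def u_def inner_commute[of x] inner_commute[of b]
        sym_mat_inner[OF X2s, of a a] matrix_inv_mult_vector X2i P2i Y2i)
qed

lemma lipschitz_on_matrix_vector_mult [lipschitz_intros]:
  fixes f :: "'a::metric_space \<Rightarrow> real^'n::finite"
  assumes "C-lipschitz_on U f"
  shows "(onorm ((*v) M) * C)-lipschitz_on U (\<lambda>x. M *v f x)"
proof (rule lipschitz_onI)
  fix x y assume "x \<in> U" "y \<in> U"
  have "dist (M *v f x) (M *v f y) \<le> onorm ((*v) M) * dist (f x) (f y)"
    using onorm[of "(*v) M" "f x - f y"] by (simp add: dist_norm matrix_vector_mult_diff_distrib)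
  also have "\<dots> \<le> onorm ((*v) M) * (C * dist x y)"
    using lipschitz_onD[OF assms \<open>x \<in> U\<close> \<open>y \<in> U\<close>] by (intro mult_left_mono onorm_pos_le) auto
  finally show "dist (M *v f x) (M *v f y) \<le> onorm ((*v) M) * C * dist x y" by (simp add: mult.assoc)
next
  show "0 \<le> onorm ((*v) M) * C" using lipschitz_on_nonneg[OF assms] by (simp add: onorm_pos_le)
qed

lemma lipschitz_on_fst [lipschitz_intros]:
  assumes "C-lipschitz_on U f"
  shows "C-lipschitz_on U (\<lambda>x. fst (f x))"
proof -
  have "1-lipschitz_on (f ` U) fst" by (rule lipschitz_onI) (simp_all add: dist_fst_le)
  from lipschitz_on_compose2[OF assms this] show ?thesis by simp
qed

lemma lipschitz_on_snd [lipschitz_intros]: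
  assumes "C-lipschitz_on U f"
  shows "C-lipschitz_on U (\<lambda>x. snd (f x))"
proof -
  have "1-lipschitz_on (f ` U) snd" by (rule lipschitz_onI) (simp_all add: dist_snd_le)
  from lipschitz_on_compose2[OF assms this] show ?thesis by simp
qed

lemma lipschitz_on_UNIV_compose:
  "D-lipschitz_on UNIV g \<Longrightarrow> C-lipschitz_on U f \<Longrightarrow> (D * C)-lipschitz_on U (\<lambda>x. g (f x))"
  by (rule lipschitz_on_compose2) (auto intro: lipschitz_on_subset)

lemma has_integral_Pair:
  assumes "(f has_integral i) S" "(g has_integral j) S"
  shows "((\<lambda>s. (f s, g s)) has_integral (i, j)) S"
proof -
  have "((\<lambda>s. (f s, 0)) has_integral (i, 0)) S"
    using has_integral_linear[OF assms(1) bounded_linear_Pair[OF bounded_linear_ident bounded_linear_zero]]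
    by (simp add: o_def)
  moreover have "((\<lambda>s. (0, g s)) has_integral (0, j)) S"
    using has_integral_linear[OF assms(2) bounded_linear_Pair[OF bounded_linear_zero bounded_linear_ident]]
    by (simp add: o_def)
  ultimately have "((\<lambda>s. (f s, 0) + (0, g s)) has_integral (i, 0) + (0, j)) S" by (rule has_integral_add)
  then show ?thesis by simp
qed

definition closed_loop_field ::
  "real^'x::finite^'x \<Rightarrow> real^'u::finite^'x \<Rightarrow> real^'p::finite^'x \<Rightarrow> real^'w::finite^'x \<Rightarrow> real^'x^'y::finite \<Rightarrow>
   real^'w^'y \<Rightarrow> real^'x^'q::finite \<Rightarrow> (real^'q \<Rightarrow> real^'p) \<Rightarrow> real^'x^'u \<Rightarrow> real^'p^'u \<Rightarrow>
   real^'y^'q \<Rightarrow> real^'y^'x \<Rightarrow> (real^'x) \<times> (real^'x) \<Rightarrow> real^'w \<Rightarrow> (real^'x) \<times> (real^'x)" where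
  "closed_loop_field A B E Ew C Fw Cq p K1 K2 L1 L2 y w =
     (state_field A B E Ew Cq p K1 K2 (fst y) w - B *v feedback_mismatch Cq p K1 K2 (fst y) (snd y),
      estimation_error_field A E Ew C Fw Cq p L1 L2 (fst y) (snd y) w)"

lemma closed_loop_field_Pair:
  "closed_loop_field A B E Ew C Fw Cq p K1 K2 L1 L2 (x, e) v =
    ((A + B ** K1) *v x + (E + B ** K2) *v p (Cq *v x) - B *v (K1 *v e - K2 *v (p (Cq *v (x - e)) - p (Cq *v x)))
       + Ew *v v,
     (A + L2 ** C) *v e - E *v (p (Cq *v x + (- ((Cq + L1 ** C) *v e) - L1 *v (Fw *v v))) - p (Cq *v x))
       + (Ew + L2 ** Fw) *v v)"
  by (simp add: closed_loop_field_def state_field_def feedback_mismatch_def estimation_error_field_def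
      diff_add_eq)

lemma closed_loop_sol_has_integral:
  assumes "closed_loop_sol A B E Ew C Fw Cq p K1 K2 L1 L2 w x e" "0 \<le> t"
  shows "((\<lambda>s. closed_loop_field A B E Ew C Fw Cq p K1 K2 L1 L2 (x s, e s) (w s))
           has_integral ((x t, e t) - (x 0, e 0))) {0..t}"
proof -
  have "((\<lambda>s. fst (closed_loop_field A B E Ew C Fw Cq p K1 K2 L1 L2 (x s, e s) (w s))) has_integral (x t - x 0)) {0..t}"
    and "((\<lambda>s. snd (closed_loop_field A B E Ew C Fw Cq p K1 K2 L1 L2 (x s, e s) (w s))) has_integral (e t - e 0)) {0..t}"
    using assms unfolding closed_loop_sol_def Let_def closed_loop_field_Pair by simp_all
  from has_integral_Pair[OF this] show ?thesis by simp
qed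

lemma closed_loop_field_zero:
  "p 0 = 0 \<Longrightarrow> closed_loop_field A B E Ew C Fw Cq p K1 K2 L1 L2 0 0 = 0"
  by (simp add: closed_loop_field_def state_field_def feedback_mismatch_def estimation_error_field_def
      zero_prod_def)

lemma lipschitz_closed_loop_field:
  assumes "Lp-lipschitz_on UNIV p"
  obtains L where "L-lipschitz_on UNIV (\<lambda>(y, w). closed_loop_field A B E Ew C Fw Cq p K1 K2 L1 L2 y w)"
proof -
  have "\<exists>L. L-lipschitz_on UNIV (\<lambda>z. closed_loop_field A B E Ew C Fw Cq p K1 K2 L1 L2 (fst z) (snd z))"
    unfolding closed_loop_field_def state_field_def feedback_mismatch_def estimation_error_field_def
    by (rule exI) (rule lipschitz_intros lipschitz_on_UNIV_compose[OF assms])+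
  then show thesis using that by (auto simp: split_beta')
qed

lemma feedback_mismatch_bound:
  assumes "Lp-lipschitz_on UNIV p"
  shows "norm (feedback_mismatch Cq p K1 K2 x e)
           \<le> (onorm ((*v) K1) + onorm ((*v) K2) * Lp * onorm ((*v) Cq)) * norm e"
proof -
  have "norm (p (Cq *v (x - e)) - p (Cq *v x)) \<le> Lp * norm (Cq *v e)"
    using lipschitz_on_normD[OF assms, of "Cq *v (x - e)" "Cq *v x"]
    by (simp add: matrix_vector_mult_diff_distrib)
  also have "\<dots> \<le> Lp * (onorm ((*v) Cq) * norm e)"
    by (intro mult_left_mono onorm lipschitz_on_nonneg[OF assms]) simp
  finally have p: "norm (p (Cq *v (x - e)) - p (Cq *v x)) \<le> Lp * (onorm ((*v) Cq) * norm e)" .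
  have "norm (feedback_mismatch Cq p K1 K2 x e)
      \<le> norm (K1 *v e) + norm (K2 *v (p (Cq *v (x - e)) - p (Cq *v x)))"
    unfolding feedback_mismatch_def by (rule norm_triangle_ineq4)
  also have "\<dots> \<le> onorm ((*v) K1) * norm e + onorm ((*v) K2) * (Lp * (onorm ((*v) Cq) * norm e))"
  proof (rule add_mono)
    show "norm (K1 *v e) \<le> onorm ((*v) K1) * norm e" by (simp add: onorm)
    have "norm (K2 *v (p (Cq *v (x - e)) - p (Cq *v x)))
        \<le> onorm ((*v) K2) * norm (p (Cq *v (x - e)) - p (Cq *v x))" by (simp add: onorm)
    also have "\<dots> \<le> onorm ((*v) K2) * (Lp * (onorm ((*v) Cq) * norm e))"
      using p by (simp add: mult_left_mono onorm_pos_le)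
    finally show "norm (K2 *v (p (Cq *v (x - e)) - p (Cq *v x))) \<le> \<dots>" .
  qed
  finally show ?thesis by (simp add: algebra_simps)
qed

lemma inner_feedback_mismatch_le:
  assumes "Lp-lipschitz_on UNIV p"
  shows "- ((Q *v x) \<bullet> (B *v feedback_mismatch Cq p K1 K2 x e))
           \<le> onorm ((*v) Q) * onorm ((*v) B) * (onorm ((*v) K1) + onorm ((*v) K2) * Lp * onorm ((*v) Cq))
               * norm x * norm e"
proof -
  have "- ((Q *v x) \<bullet> (B *v feedback_mismatch Cq p K1 K2 x e))
      \<le> onorm ((*v) B) * norm (Q *v x) * norm (feedback_mismatch Cq p K1 K2 x e)"
    using inner_matrix_vector_le[of "Q *v x" B "- feedback_mismatch Cq p K1 K2 x e"]
    by (simp add: matrix_vector_mult_uminus_right)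
  also have "\<dots> \<le> onorm ((*v) B) * (onorm ((*v) Q) * norm x)
      * ((onorm ((*v) K1) + onorm ((*v) K2) * Lp * onorm ((*v) Cq)) * norm e)"
  proof (intro mult_mono mult_left_mono onorm feedback_mismatch_bound[OF assms] onorm_pos_le)
    show "0 \<le> onorm ((*v) B) * (onorm ((*v) Q) * norm x)"
      by (intro mult_nonneg_nonneg onorm_pos_le norm_ge_zero) simp_all
  qed simp_all
  finally show ?thesis by (simp add: mult_ac)
qed

lemma le_sqrt_of_quadratic_le:
  fixes a b c r s :: real
  assumes "0 < c" "0 \<le> s" and quad: "c * r\<^sup>2 \<le> a * s\<^sup>2 + b * s * r"
  shows "r \<le> sqrt (2 * a / c + b\<^sup>2 / c\<^sup>2) * s"
proof -
  have "2 * c * (b * s * r) \<le> c\<^sup>2 * r\<^sup>2 + b\<^sup>2 * s\<^sup>2"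
    using sum_squares_bound[of "c * r" "b * s"] by (simp add: algebra_simps)
  then have "c\<^sup>2 * r\<^sup>2 \<le> (2 * a * c + b\<^sup>2) * s\<^sup>2"
    using mult_left_mono[OF quad, of "2 * c"] assms(1) by (simp add: power2_eq_square algebra_simps)
  then have "r\<^sup>2 \<le> (2 * a / c + b\<^sup>2 / c\<^sup>2) * s\<^sup>2"
    using assms(1) by (simp add: field_simps power2_eq_square)
  then have "sqrt (r\<^sup>2) \<le> sqrt ((2 * a / c + b\<^sup>2 / c\<^sup>2) * s\<^sup>2)" by (rule real_sqrt_le_mono)
  then show ?thesis using assms(2) by (simp add: real_sqrt_mult)
qed

lemma delta_MM_lipschitz:
  fixes p :: "real^'q::finite \<Rightarrow> real^'p::finite"
  assumes MM: "delta_MM p M" and neg: "neg_def (blk4 M)"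
  obtains Lp where "Lp-lipschitz_on UNIV p"
proof -
  obtain c where c: "0 < c" "\<And>v. c * (norm v)\<^sup>2 \<le> v \<bullet> (- blk4 M *v v)"
    using quadratic_form_lower_bound[of "(*v) (- blk4 M)"] neg by (auto simp: neg_def_def pos_def_def)
  define K1 where "K1 = onorm ((*v) (blk1 M))"
  define K where "K = onorm ((*v) (blk2 M)) + onorm ((*v) (blk3 M))"
  have "norm (p q2 - p q1) \<le> sqrt (2 * K1 / c + K\<^sup>2 / c\<^sup>2) * norm (q2 - q1)" for q1 q2
  proof (rule le_sqrt_of_quadratic_le[OF c(1) norm_ge_zero])
    define s r where "s = q2 - q1" and "r = p q2 - p q1"
    have "0 \<le> vcat s r \<bullet> (M *v vcat s r)"
      using MM unfolding delta_MM_def Let_def s_def r_def by blast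
    then have "0 \<le> s \<bullet> (blk1 M *v s) + s \<bullet> (blk2 M *v r) + r \<bullet> (blk3 M *v s) + r \<bullet> (blk4 M *v r)"
      by (simp add: matrix_vector_mult_vcat_blocks inner_vcat inner_add_right)
    moreover have "c * (norm r)\<^sup>2 \<le> - (r \<bullet> (blk4 M *v r))"
      using c(2)[of r] by (simp add: matrix_vector_mult_uminus_left)
    moreover have "s \<bullet> (blk1 M *v s) \<le> K1 * (norm s)\<^sup>2"
      using inner_matrix_vector_le[of s "blk1 M" s] by (simp add: K1_def power2_eq_square mult_ac)
    moreover have "s \<bullet> (blk2 M *v r) + r \<bullet> (blk3 M *v s) \<le> K * norm s * norm r"
      using inner_matrix_vector_le[of s "blk2 M" r] inner_matrix_vector_le[of r "blk3 M" s]
      by (simp add: K_def algebra_simps)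
    ultimately show "c * (norm r)\<^sup>2 \<le> K1 * (norm s)\<^sup>2 + K * norm s * norm r" by linarith
  qed
  then have "(sqrt (2 * K1 / c + K\<^sup>2 / c\<^sup>2))-lipschitz_on UNIV p"
    using c(1) by (intro lipschitz_onI) (auto simp: dist_norm K1_def K_def onorm_pos_le)
  then show thesis by (rule that)
qed

text \<open>Young's inequality, with the weight \<kappa> chosen so that the decay of Y dominates the cross term.\<close>
lemma absorb_cross_term:
  fixes \<alpha>1 \<alpha>2 lx le G :: real
  assumes "0 < \<alpha>1" "0 < \<alpha>2" "0 < lx" "0 < le"
  obtains \<kappa> where "0 < \<kappa>"
    "\<And>X Y nx ne c. lx * nx\<^sup>2 \<le> X \<Longrightarrow> le * ne\<^sup>2 \<le> Y \<Longrightarrow> c \<le> G * nx * ne \<Longrightarrow>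
       2 * c - \<alpha>2 * X - \<kappa> * (\<alpha>1 * Y) \<le> - (min \<alpha>1 \<alpha>2 / 2) * (X + \<kappa> * Y)"
proof -
  define \<epsilon> where "\<epsilon> = \<alpha>2 * lx / 2"
  define D where "D = G\<^sup>2 / (\<epsilon> * le)"
  define \<kappa> where "\<kappa> = 2 * D / \<alpha>1 + 1"
  have \<epsilon>: "0 < \<epsilon>" and D: "0 \<le> D" using assms by (simp_all add: \<epsilon>_def D_def)
  have \<kappa>: "0 < \<kappa>" and \<kappa>_eq: "\<alpha>1 / 2 * \<kappa> = D + \<alpha>1 / 2"
    using D assms by (simp_all add: \<kappa>_def field_simps)
  have "2 * c - \<alpha>2 * X - \<kappa> * (\<alpha>1 * Y) \<le> - (min \<alpha>1 \<alpha>2 / 2) * (X + \<kappa> * Y)"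
    if X: "lx * nx\<^sup>2 \<le> X" and Y: "le * ne\<^sup>2 \<le> Y" and c: "c \<le> G * nx * ne" for X Y nx ne c
  proof -
    have "0 \<le> (\<epsilon> * nx - G * ne)\<^sup>2" by simp
    then have "2 * (G * nx * ne) \<le> \<epsilon> * nx\<^sup>2 + G\<^sup>2 / \<epsilon> * ne\<^sup>2"
      using \<epsilon> by (simp add: field_simps power2_eq_square)
    also have "\<epsilon> * nx\<^sup>2 \<le> \<alpha>2 / 2 * X" using X assms by (simp add: \<epsilon>_def)
    also have "G\<^sup>2 / \<epsilon> * ne\<^sup>2 = D * (le * ne\<^sup>2)" using assms by (simp add: D_def \<epsilon>_def)
    also have "\<dots> \<le> D * Y" using Y D by (rule mult_left_mono)
    finally have cross: "2 * c \<le> \<alpha>2 / 2 * X + D * Y" using c by linarith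
    have "0 \<le> X" "0 \<le> Y"
      using X Y assms(3,4) by (meson mult_nonneg_nonneg order_trans less_imp_le zero_le_power2)+
    then have "min \<alpha>1 \<alpha>2 / 2 * X \<le> \<alpha>2 / 2 * X" "min \<alpha>1 \<alpha>2 / 2 * (\<kappa> * Y) \<le> \<alpha>1 / 2 * (\<kappa> * Y)"
      "0 \<le> \<alpha>1 / 2 * Y"
      using \<kappa> assms(1) by (simp_all add: mult_right_mono)
    moreover have "\<alpha>1 / 2 * (\<kappa> * Y) = D * Y + \<alpha>1 / 2 * Y" using \<kappa>_eq by (metis distrib_right mult.assoc)
    moreover have "\<kappa> * (\<alpha>1 * Y) = 2 * (\<alpha>1 / 2 * (\<kappa> * Y))"
      and "- (min \<alpha>1 \<alpha>2 / 2) * (X + \<kappa> * Y) = - (min \<alpha>1 \<alpha>2 / 2 * X) - min \<alpha>1 \<alpha>2 / 2 * (\<kappa> * Y)"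
      by (simp_all add: algebra_simps)
    ultimately show ?thesis using cross by linarith
  qed
  with \<kappa> show thesis by (rule that)
qed

lemma closed_loop_dissipation:
  fixes Q P1 :: "real^'x::finite^'x" and p :: "real^'q::finite \<Rightarrow> real^'p::finite"
    and B :: "real^'u::finite^'x" and Ew :: "real^'w::finite^'x"
  assumes Q: "pos_def Q" and P1: "pos_def P1" and \<alpha>: "0 < \<alpha>1" "0 < \<alpha>2"
    and Lp: "Lp-lipschitz_on UNIV p"
    and ctrl: "\<And>x w. 2 * ((Q *v x) \<bullet> state_field A B E Ew Cq p K1 K2 x w)
                 \<le> \<mu>2 * (norm w)\<^sup>2 - \<alpha>2 * (x \<bullet> (Q *v x))"
    and obs: "\<And>x e w. 2 * ((P1 *v e) \<bullet> estimation_error_field A E Ew C Fw Cq p L1 L2 x e w)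
                 \<le> \<mu>1 * (norm w)\<^sup>2 - \<alpha>1 * (e \<bullet> (P1 *v e))"
  obtains \<kappa> where "0 < \<kappa>"
    "\<And>y w. 2 * ((Q *v fst y, \<kappa> *\<^sub>R (P1 *v snd y)) \<bullet> closed_loop_field A B E Ew C Fw Cq p K1 K2 L1 L2 y w)
       \<le> - (min \<alpha>1 \<alpha>2 / 2) * (y \<bullet> (Q *v fst y, \<kappa> *\<^sub>R (P1 *v snd y))) + (\<mu>2 + \<kappa> * \<mu>1) * (norm w)\<^sup>2"
proof -
  obtain lx where lx: "0 < lx" "\<And>v. lx * (norm v)\<^sup>2 \<le> v \<bullet> (Q *v v)"
    using quadratic_form_lower_bound[of "(*v) Q"] Q by (auto simp: pos_def_def)
  obtain le where le: "0 < le" "\<And>v. le * (norm v)\<^sup>2 \<le> v \<bullet> (P1 *v v)"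
    using quadratic_form_lower_bound[of "(*v) P1"] P1 by (auto simp: pos_def_def)
  define G where "G = onorm ((*v) Q) * onorm ((*v) B) * (onorm ((*v) K1) + onorm ((*v) K2) * Lp * onorm ((*v) Cq))"
  obtain \<kappa> where \<kappa>: "0 < \<kappa>" and absorb: "\<And>X Y nx ne c. lx * nx\<^sup>2 \<le> X \<Longrightarrow> le * ne\<^sup>2 \<le> Y \<Longrightarrow>
      c \<le> G * nx * ne \<Longrightarrow> 2 * c - \<alpha>2 * X - \<kappa> * (\<alpha>1 * Y) \<le> - (min \<alpha>1 \<alpha>2 / 2) * (X + \<kappa> * Y)"
    using absorb_cross_term[OF \<alpha> lx(1) le(1)] by blast
  have "2 * ((Q *v x, \<kappa> *\<^sub>R (P1 *v e)) \<bullet> closed_loop_field A B E Ew C Fw Cq p K1 K2 L1 L2 (x, e) w)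
       \<le> - (min \<alpha>1 \<alpha>2 / 2) * ((x, e) \<bullet> (Q *v x, \<kappa> *\<^sub>R (P1 *v e))) + (\<mu>2 + \<kappa> * \<mu>1) * (norm w)\<^sup>2" for x e w
  proof -
    have cross: "- ((Q *v x) \<bullet> (B *v feedback_mismatch Cq p K1 K2 x e)) \<le> G * norm x * norm e"
      using inner_feedback_mismatch_le[OF Lp] by (simp add: G_def)
    have obs\<kappa>: "\<kappa> * (2 * ((P1 *v e) \<bullet> estimation_error_field A E Ew C Fw Cq p L1 L2 x e w))
        \<le> \<kappa> * (\<mu>1 * (norm w)\<^sup>2 - \<alpha>1 * (e \<bullet> (P1 *v e)))"
      using obs \<kappa> by (simp add: mult_left_mono)
    show ?thesis
      using absorb[OF lx(2)[of x] le(2)[of e] cross] ctrl[of x w] obs\<kappa>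
      by (simp add: closed_loop_field_def algebra_simps)
  qed
  then show thesis using that[OF \<kappa>] by (metis prod.collapse)
qed

lemma has_integral_increment:
  fixes f :: "real \<Rightarrow> 'a::banach"
  assumes sol: "\<And>t. 0 \<le> t \<Longrightarrow> (f has_integral (y t - y 0)) {0..t}" and "0 \<le> s" "s \<le> t"
  shows "(f has_integral (y t - y s)) {s..t}"
proof -
  have ft: "(f has_integral (y t - y 0)) {0..t}" and fs: "(f has_integral (y s - y 0)) {0..s}"
    using sol assms(2,3) by auto
  have "integral {0..s} f + integral {s..t} f = integral {0..t} f"
    using Henstock_Kurzweil_Integration.integral_combine[OF assms(2,3)] ft by blast
  then have "integral {s..t} f = y t - y s" using ft fs by (simp add: integral_unique algebra_simps)
  moreover have "f integrable_on {s..t}" using integrable_subinterval_real[of f 0 t s t] ft assms(2) by auto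
  ultimately show ?thesis by (simp add: has_integral_integrable_integral)
qed

lemma continuous_on_of_has_integral:
  fixes f :: "real \<Rightarrow> 'a::banach"
  assumes sol: "\<And>t. 0 \<le> t \<Longrightarrow> (f has_integral (y t - y 0)) {0..t}" and "0 \<le> T"
  shows "continuous_on {0..T} y"
proof -
  have "continuous_on {0..T} (\<lambda>s. y 0 + integral {0..s} f)"
    using sol[OF assms(2)] by (intro continuous_intros indefinite_integral_continuous_1) auto
  moreover have "y 0 + integral {0..s} f = y s" if "s \<in> {0..T}" for s
    using sol[of s] that by (simp add: integral_unique)
  ultimately show ?thesis by (rule continuous_on_eq) simp
qed

lemma Euler_steps_bound:
  fixes v :: "real \<Rightarrow> real" and n k :: nat
  assumes step: "\<And>s h. 0 \<le> s \<Longrightarrow> 0 \<le> h \<Longrightarrow> s + h \<le> T \<Longrightarrow> v (s + h) \<le> (1 - \<alpha> * h) * v s + h * (c + C * h)"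
    and "0 < \<alpha>" "0 < n" "0 \<le> T" "\<alpha> * (T / n) \<le> 1" "0 \<le> c + C * (T / n)" "k \<le> n"
  shows "v (real k * (T / n)) \<le> (1 - \<alpha> * (T / n)) ^ k * v 0 + (c + C * (T / n)) / \<alpha>"
  using \<open>k \<le> n\<close>
proof (induction k)
  case 0
  then show ?case using assms(2,6) by simp
next
  case (Suc k)
  define h where "h = T / n"
  have h: "0 \<le> h" "0 \<le> 1 - \<alpha> * h" using assms(3-5) by (simp_all add: h_def)
  have "real k + 1 \<le> real n" using Suc.prems by simp
  from mult_right_mono[OF this h(1)] have "real k * h + h \<le> real n * h" by (simp add: distrib_right)
  then have "real k * h + h \<le> T" using assms(3) by (simp add: h_def)
  then have "v (real (Suc k) * h) \<le> (1 - \<alpha> * h) * v (real k * h) + h * (c + C * h)"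
    using step[of "real k * h" h] h by (simp add: algebra_simps)
  also have "\<dots> \<le> (1 - \<alpha> * h) * ((1 - \<alpha> * h) ^ k * v 0 + (c + C * h) / \<alpha>) + h * (c + C * h)"
    using Suc h by (intro add_right_mono mult_left_mono) (auto simp: h_def)
  also have "\<dots> = (1 - \<alpha> * h) ^ Suc k * v 0 + (c + C * h) / \<alpha>"
    using assms(2) by (simp add: field_simps)
  finally show ?case by (simp add: h_def)
qed

text \<open>Letting the step size of the discrete Gronwall estimate tend to zero.\<close>
lemma exp_decay_of_Euler_steps:
  fixes v :: "real \<Rightarrow> real"
  assumes step: "\<And>s h. 0 \<le> s \<Longrightarrow> 0 \<le> h \<Longrightarrow> s + h \<le> T \<Longrightarrow> v (s + h) \<le> (1 - \<alpha> * h) * v s + h * (c + C * h)"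
    and "0 < \<alpha>" "0 \<le> c" "0 \<le> C" "0 \<le> T"
  shows "v T \<le> exp (- \<alpha> * T) * v 0 + c / \<alpha>"
proof -
  have lim: "(\<lambda>n. (1 + (- \<alpha> * T) / real n) ^ n * v 0 + (c + C * (T / real n)) / \<alpha>)
      \<longlonglongrightarrow> exp (- \<alpha> * T) * v 0 + (c + C * 0) / \<alpha>"
    by (intro tendsto_intros tendsto_exp_limit_sequentially tendsto_divide_0[OF tendsto_const]
        filterlim_real_sequentially) (use assms(2) in simp)
  obtain N :: nat where N: "\<alpha> * T \<le> N" by (meson real_nat_ceiling_ge)
  have "v T \<le> (1 + (- \<alpha> * T) / real n) ^ n * v 0 + (c + C * (T / real n)) / \<alpha>" if "N + 1 \<le> n" for n
  proof -
    have "0 < n" "\<alpha> * (T / n) \<le> 1" using that N by (auto simp: field_simps)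
    from Euler_steps_bound[OF step assms(2) this(1) assms(5) this(2) _ order_refl] this(1) assms(3-5)
    show ?thesis by (simp add: field_simps)
  qed
  then have "v T \<le> exp (- \<alpha> * T) * v 0 + (c + C * 0) / \<alpha>"
    by (intro LIMSEQ_le_const[OF lim]) blast
  then show ?thesis by simp
qed

locale dissipative_trajectory =
  fixes H :: "'a::euclidean_space \<Rightarrow> 'a" and F :: "'a \<Rightarrow> 'b::real_normed_vector \<Rightarrow> 'a"
    and y :: "real \<Rightarrow> 'a" and w :: "real \<Rightarrow> 'b" and L \<alpha> m W :: real
  assumes H: "bounded_linear H" and H_sym: "\<And>a b. a \<bullet> H b = H a \<bullet> b"
    and F_lipschitz: "L-lipschitz_on UNIV (\<lambda>(a, v). F a v)" and F_zero: "F 0 0 = 0"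
    and dissipative: "\<And>a v. 2 * (H a \<bullet> F a v) \<le> - \<alpha> * (a \<bullet> H a) + m * (norm v)\<^sup>2" and m: "0 \<le> m"
    and w_bound: "\<And>s. 0 \<le> s \<Longrightarrow> norm (w s) \<le> W"
    and solution: "\<And>t. 0 \<le> t \<Longrightarrow> ((\<lambda>s. F (y s) (w s)) has_integral (y t - y 0)) {0..t}"
begin

lemma lipschitz_const_nonneg: "0 \<le> L"
  using F_lipschitz by (rule lipschitz_on_nonneg)

lemma disturbance_bound_nonneg: "0 \<le> W"
  using w_bound[of 0] norm_ge_zero order_trans by blast

lemma F_lipschitz_state: "norm (F a v - F b v) \<le> L * norm (a - b)"
  using lipschitz_on_normD[OF F_lipschitz, of "(a, v)" "(b, v)"] by simp

lemma F_linear_growth: "norm (F a v) \<le> L * (norm a + norm v)"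
proof -
  have "norm (F a v) \<le> L * norm (a, v)"
    using lipschitz_on_normD[OF F_lipschitz, of "(a, v)" "(0, 0)"] by (simp add: F_zero zero_prod_def)
  also have "\<dots> \<le> L * (norm a + norm v)" by (intro mult_left_mono norm_Pair_le lipschitz_const_nonneg)
  finally show ?thesis .
qed

lemma quadratic_form_add: "(a + d) \<bullet> H (a + d) = a \<bullet> H a + 2 * (H a \<bullet> d) + d \<bullet> H d"
  using H_sym[of a d] H_sym[of d a]
  by (simp add: linear_add[OF bounded_linear.linear[OF H]] inner_add_left inner_add_right inner_commute)

lemma solution_bounds:
  assumes "0 \<le> T"
  obtains By Mf where "0 \<le> By" "0 \<le> Mf" "\<And>s. s \<in> {0..T} \<Longrightarrow> norm (y s) \<le> By"
    "\<And>s t. 0 \<le> s \<Longrightarrow> s \<le> t \<Longrightarrow> t \<le> T \<Longrightarrow> norm (y t - y s) \<le> Mf * (t - s)"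
proof -
  have "bounded (y ` {0..T})"
    by (intro compact_imp_bounded compact_continuous_image continuous_on_of_has_integral[OF solution assms]
        compact_Icc)
  then obtain B where B: "\<And>s. s \<in> {0..T} \<Longrightarrow> norm (y s) \<le> B" unfolding bounded_iff by blast
  define By where "By = max B 0"
  have By: "0 \<le> By" "\<And>s. s \<in> {0..T} \<Longrightarrow> norm (y s) \<le> By" using B by (force simp: By_def)+
  have Mf: "0 \<le> L * (By + W)" using By(1) lipschitz_const_nonneg disturbance_bound_nonneg by simp
  have F_bound: "norm (F (y s) (w s)) \<le> L * (By + W)" if "s \<in> {0..T}" for s
  proof -
    have "norm (F (y s) (w s)) \<le> L * (norm (y s) + norm (w s))" by (rule F_linear_growth)
    also have "\<dots> \<le> L * (By + W)"
      using By(2)[OF that] w_bound[of s] that by (intro mult_left_mono add_mono lipschitz_const_nonneg) auto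
    finally show ?thesis .
  qed
  have "norm (y t - y s) \<le> L * (By + W) * (t - s)" if "0 \<le> s" "s \<le> t" "t \<le> T" for s t
  proof -
    have "norm (y t - y s) \<le> L * (By + W) * Henstock_Kurzweil_Integration.content (cbox s t)"
      using has_integral_increment[OF solution that(1,2)] F_bound that
      by (intro has_integral_bound[OF Mf]) auto
    then show ?thesis using that by simp
  qed
  from By(1) Mf By(2) this show thesis by (rule that)
qed

lemma inner_increment_le:
  assumes "0 \<le> s" "s \<le> t" and near: "\<And>r. r \<in> {s..t} \<Longrightarrow> norm (y r - y s) \<le> \<delta>"
  shows "2 * (H (y s) \<bullet> (y t - y s))
           \<le> (t - s) * (m * W\<^sup>2 - \<alpha> * (y s \<bullet> H (y s)) + 2 * norm (H (y s)) * (L * \<delta>))"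
proof -
  have "((\<lambda>r. 2 * (H (y s) \<bullet> F (y r) (w r))) has_integral 2 * (H (y s) \<bullet> (y t - y s))) {s..t}"
    using has_integral_linear[OF has_integral_increment[OF solution assms(1,2)],
        of "\<lambda>v. 2 * (H (y s) \<bullet> v)"]
    by (simp add: o_def bounded_linear_const_mult bounded_linear_inner_right)
  moreover have "2 * (H (y s) \<bullet> F (y r) (w r))
      \<le> m * W\<^sup>2 - \<alpha> * (y s \<bullet> H (y s)) + 2 * norm (H (y s)) * (L * \<delta>)" if r: "r \<in> {s..t}" for r
  proof -
    have "H (y s) \<bullet> (F (y r) (w r) - F (y s) (w r)) \<le> norm (H (y s)) * norm (F (y r) (w r) - F (y s) (w r))"
      by (rule norm_cauchy_schwarz)
    also have "\<dots> \<le> norm (H (y s)) * (L * \<delta>)"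
      using F_lipschitz_state[of "y r" "w r" "y s"] near[OF r] lipschitz_const_nonneg
      by (intro mult_left_mono) (auto intro: order_trans mult_left_mono)
    finally have "H (y s) \<bullet> (F (y r) (w r) - F (y s) (w r)) \<le> norm (H (y s)) * (L * \<delta>)" .
    moreover have "m * (norm (w r))\<^sup>2 \<le> m * W\<^sup>2"
      using w_bound[of r] r assms(1) m by (intro mult_left_mono power_mono) auto
    ultimately show ?thesis
      using dissipative[of "y s" "w r"] by (simp add: algebra_simps)
  qed
  ultimately have "2 * (H (y s) \<bullet> (y t - y s))
      \<le> Henstock_Kurzweil_Integration.content {s..t} *\<^sub>R (m * W\<^sup>2 - \<alpha> * (y s \<bullet> H (y s)) + 2 * norm (H (y s)) * (L * \<delta>))"
    by (rule has_integral_le[OF _ has_integral_const_real])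
  then show ?thesis using assms(2) by simp
qed

lemma Lyapunov_increment_le:
  assumes "0 \<le> s" "0 \<le> h" and near: "\<And>r. r \<in> {s..s + h} \<Longrightarrow> norm (y r - y s) \<le> \<delta>"
  shows "y (s + h) \<bullet> H (y (s + h)) \<le> (1 - \<alpha> * h) * (y s \<bullet> H (y s))
           + h * (m * W\<^sup>2 + 2 * norm (H (y s)) * (L * \<delta>)) + onorm H * \<delta>\<^sup>2"
proof -
  define d where "d = y (s + h) - y s"
  have "norm d \<le> \<delta>" using near[of "s + h"] assms(2) by (simp add: d_def)
  then have "d \<bullet> H d \<le> onorm H * \<delta>\<^sup>2"
    using quadratic_form_upper_bound[OF H, of d] onorm_pos_le[OF H]
    by (meson norm_ge_zero order_trans mult_left_mono power_mono)
  moreover have "2 * (H (y s) \<bullet> d) \<le> h * (m * W\<^sup>2 - \<alpha> * (y s \<bullet> H (y s)) + 2 * norm (H (y s)) * (L * \<delta>))"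
    using inner_increment_le[of s "s + h" \<delta>] assms by (simp add: d_def)
  moreover have "y (s + h) \<bullet> H (y (s + h)) = y s \<bullet> H (y s) + 2 * (H (y s) \<bullet> d) + d \<bullet> H d"
    using quadratic_form_add[of "y s" d] by (simp add: d_def)
  ultimately show ?thesis by (simp add: algebra_simps)
qed

lemma Lyapunov_Euler_step:
  assumes "0 \<le> T"
  obtains C where "0 \<le> C" "\<And>s h. 0 \<le> s \<Longrightarrow> 0 \<le> h \<Longrightarrow> s + h \<le> T \<Longrightarrow>
    y (s + h) \<bullet> H (y (s + h)) \<le> (1 - \<alpha> * h) * (y s \<bullet> H (y s)) + h * (m * W\<^sup>2 + C * h)"
proof -
  obtain By Mf where By: "0 \<le> By" "\<And>s. s \<in> {0..T} \<Longrightarrow> norm (y s) \<le> By" and Mf: "0 \<le> Mf"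
    and y_lip: "\<And>s t. 0 \<le> s \<Longrightarrow> s \<le> t \<Longrightarrow> t \<le> T \<Longrightarrow> norm (y t - y s) \<le> Mf * (t - s)"
    using solution_bounds[OF assms] by metis
  define C where "C = 2 * (onorm H * By) * (L * Mf) + onorm H * Mf\<^sup>2"
  have "0 \<le> C" using By Mf lipschitz_const_nonneg onorm_pos_le[OF H] by (simp add: C_def)
  moreover have "y (s + h) \<bullet> H (y (s + h)) \<le> (1 - \<alpha> * h) * (y s \<bullet> H (y s)) + h * (m * W\<^sup>2 + C * h)"
    if s: "0 \<le> s" "0 \<le> h" "s + h \<le> T" for s h
  proof -
    have "norm (y r - y s) \<le> Mf * h" if "r \<in> {s..s + h}" for r
    proof -
      have "norm (y r - y s) \<le> Mf * (r - s)" using y_lip[of s r] that s by auto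
      also have "\<dots> \<le> Mf * h" using that Mf by (intro mult_left_mono) auto
      finally show ?thesis .
    qed
    from Lyapunov_increment_le[OF s(1,2) this]
    have "y (s + h) \<bullet> H (y (s + h)) \<le> (1 - \<alpha> * h) * (y s \<bullet> H (y s))
        + h * (m * W\<^sup>2 + 2 * norm (H (y s)) * (L * (Mf * h))) + onorm H * (Mf * h)\<^sup>2" .
    moreover have "norm (H (y s)) \<le> onorm H * By"
      using onorm[OF H, of "y s"] mult_left_mono[OF By(2)[of s] onorm_pos_le[OF H]] s by simp
    then have "2 * norm (H (y s)) * (L * (Mf * h)) \<le> 2 * (onorm H * By) * (L * Mf) * h"
      using mult_right_mono[of "norm (H (y s))" "onorm H * By" "2 * (L * Mf * h)"] lipschitz_const_nonneg Mf s(2)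
      by (simp add: mult_ac)
    then have "h * (2 * norm (H (y s)) * (L * (Mf * h))) \<le> h * (2 * (onorm H * By) * (L * Mf) * h)"
      using s(2) by (rule mult_left_mono)
    ultimately show ?thesis by (simp add: C_def power2_eq_square algebra_simps)
  qed
  ultimately show thesis by (rule that)
qed

lemma Lyapunov_decay:
  assumes "0 < \<alpha>" "0 \<le> T"
  shows "y T \<bullet> H (y T) \<le> exp (- \<alpha> * T) * (y 0 \<bullet> H (y 0)) + m * W\<^sup>2 / \<alpha>"
proof -
  obtain C where "0 \<le> C" and step: "\<And>s h. 0 \<le> s \<Longrightarrow> 0 \<le> h \<Longrightarrow> s + h \<le> T \<Longrightarrow>
    y (s + h) \<bullet> H (y (s + h)) \<le> (1 - \<alpha> * h) * (y s \<bullet> H (y s)) + h * (m * W\<^sup>2 + C * h)"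
    using Lyapunov_Euler_step[OF assms(2)] by blast
  show ?thesis
    by (rule exp_decay_of_Euler_steps[where v = "\<lambda>s. y s \<bullet> H (y s)", OF step assms(1) _ \<open>0 \<le> C\<close> assms(2)])
      (use m in simp_all)
qed

end

lemma class_K_scale:
  assumes "0 < c"
  shows "class_K (\<lambda>r. c * r)"
  unfolding class_K_def
proof (intro conjI)
  show "continuous_on {0..} (\<lambda>r. c * r)" by (intro continuous_intros)
  show "strict_mono_on {0..} (\<lambda>r. c * r)" using assms by (intro strict_mono_onI) simp
qed simp

lemma class_KL_exp_decay:
  assumes "0 < c" "0 < a"
  shows "class_KL (\<lambda>r t. c * r * exp (- a * t))"
  unfolding class_KL_def
proof (intro conjI allI impI)
  show "continuous_on ({0..} \<times> {0..}) (\<lambda>(r, t). c * r * exp (- a * t))"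
    by (simp add: split_beta) (intro continuous_intros)
  fix t :: real
  show "class_K (\<lambda>r. c * r * exp (- a * t))"
    using class_K_scale[of "c * exp (- a * t)"] assms(1) by (simp add: mult_ac)
next
  fix r s t :: real assume "0 \<le> r" "0 \<le> s" "s \<le> t"
  then show "c * r * exp (- a * t) \<le> c * r * exp (- a * s)"
    using assms by (intro mult_left_mono) auto
next
  fix r :: real
  have "filterlim (\<lambda>t. - a * t) at_bot at_top"
    using assms(2) by (intro filterlim_tendsto_neg_mult_at_bot[OF tendsto_const _ filterlim_ident]) simp
  then have "((\<lambda>t. exp (- a * t)) \<longlongrightarrow> 0) at_top"
    using filterlim_compose[OF exp_at_bot] by blast
  then show "((\<lambda>t. c * r * exp (- a * t)) \<longlongrightarrow> 0) at_top"
    using tendsto_mult_right_zero by blast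
qed

lemma norm_bound_of_Lyapunov_bound:
  fixes l \<Lambda> \<alpha> m n0 nt W t :: real
  assumes "0 < l" "0 \<le> \<Lambda>" "0 < \<alpha>" "0 \<le> m" "0 \<le> n0" "0 \<le> W"
    and bound: "l * nt\<^sup>2 \<le> exp (- \<alpha> * t) * (\<Lambda> * n0\<^sup>2) + m * W\<^sup>2 / \<alpha>"
  shows "nt \<le> (sqrt (\<Lambda> / l) + 1) * n0 * exp (- (\<alpha> / 2) * t) + (sqrt (m / (\<alpha> * l)) + 1) * W"
proof -
  define u where "u = exp (- (\<alpha> / 2) * t) * n0"
  have u: "0 \<le> u" using assms(5) by (simp add: u_def)
  have "exp (- \<alpha> * t) * n0\<^sup>2 = u\<^sup>2"
    by (simp add: u_def power_mult_distrib power2_eq_square flip: exp_add)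
  then have "nt\<^sup>2 \<le> \<Lambda> / l * u\<^sup>2 + m / (\<alpha> * l) * W\<^sup>2"
    using bound assms(1,3) by (simp add: field_simps)
  then have "nt \<le> sqrt (\<Lambda> / l * u\<^sup>2 + m / (\<alpha> * l) * W\<^sup>2)"
    using real_sqrt_le_mono real_sqrt_abs abs_ge_self order_trans by metis
  also have "\<dots> \<le> sqrt (\<Lambda> / l * u\<^sup>2) + sqrt (m / (\<alpha> * l) * W\<^sup>2)"
    using assms by (intro sqrt_add_le_add_sqrt) simp_all
  also have "\<dots> = sqrt (\<Lambda> / l) * u + sqrt (m / (\<alpha> * l)) * W"
    using u assms(6) by (simp only: real_sqrt_mult real_sqrt_abs abs_of_nonneg)
  also have "\<dots> \<le> (sqrt (\<Lambda> / l) + 1) * u + (sqrt (m / (\<alpha> * l)) + 1) * W"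
    using u assms(6) by (intro add_mono mult_right_mono) auto
  finally show ?thesis by (simp add: u_def mult_ac)
qed

lemma ISS_wrt_of_quadratic_Lyapunov_function:
  fixes sol :: "(real \<Rightarrow> real^'w::finite) \<Rightarrow> (real \<Rightarrow> real^'x::finite) \<Rightarrow> (real \<Rightarrow> real^'x) \<Rightarrow> bool"
    and F :: "(real^'x) \<times> (real^'x) \<Rightarrow> real^'w \<Rightarrow> (real^'x) \<times> (real^'x)"
    and H :: "(real^'x) \<times> (real^'x) \<Rightarrow> (real^'x) \<times> (real^'x)"
  assumes sol: "\<And>w x e t. sol w x e \<Longrightarrow> 0 \<le> t \<Longrightarrow>
      ((\<lambda>s. F (x s, e s) (w s)) has_integral ((x t, e t) - (x 0, e 0))) {0..t}"
    and F: "L-lipschitz_on UNIV (\<lambda>(y, v). F y v)" "F 0 0 = 0"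
    and H: "bounded_linear H" "\<And>a b. a \<bullet> H b = H a \<bullet> b" "\<And>y. y \<noteq> 0 \<Longrightarrow> 0 < y \<bullet> H y"
    and dissipative: "\<And>y v. 2 * (H y \<bullet> F y v) \<le> - \<alpha> * (y \<bullet> H y) + m * (norm v)\<^sup>2"
    and \<alpha>: "0 < \<alpha>" and m: "0 \<le> m"
  shows "ISS_wrt sol"
proof -
  obtain l where l: "0 < l" "\<And>y. l * (norm y)\<^sup>2 \<le> y \<bullet> H y"
    using quadratic_form_lower_bound[OF H(1,3)] by blast
  define c1 where "c1 = sqrt (onorm H / l) + 1"
  define c2 where "c2 = sqrt (m / (\<alpha> * l)) + 1"
  have "norm (x t, e t) \<le> c1 * norm (x 0, e 0) * exp (- (\<alpha> / 2) * t) + c2 * (SUP s\<in>{0..}. norm (w s))"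
    if "bounded (w ` {0..})" "sol w x e" "0 \<le> t" for w x e t
  proof -
    define W where "W = (SUP s\<in>{0..}. norm (w s))"
    have "bdd_above ((\<lambda>s. norm (w s)) ` {0..})"
      using that(1) unfolding bounded_iff bdd_above_def by fastforce
    then have w_bound: "\<And>s. 0 \<le> s \<Longrightarrow> norm (w s) \<le> W" unfolding W_def by (intro cSUP_upper) auto
    interpret dissipative_trajectory H F "\<lambda>s. (x s, e s)" w L \<alpha> m W
      by (intro dissipative_trajectory.intro) (use H F dissipative m w_bound sol[OF that(2)] in simp_all)
    have "(x t, e t) \<bullet> H (x t, e t) \<le> exp (- \<alpha> * t) * ((x 0, e 0) \<bullet> H (x 0, e 0)) + m * W\<^sup>2 / \<alpha>"
      using Lyapunov_decay[OF \<alpha> that(3)] by simp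
    moreover have "exp (- \<alpha> * t) * ((x 0, e 0) \<bullet> H (x 0, e 0)) \<le> exp (- \<alpha> * t) * (onorm H * (norm (x 0, e 0))\<^sup>2)"
      by (intro mult_left_mono quadratic_form_upper_bound H(1)) simp
    ultimately have "l * (norm (x t, e t))\<^sup>2 \<le> exp (- \<alpha> * t) * (onorm H * (norm (x 0, e 0))\<^sup>2) + m * W\<^sup>2 / \<alpha>"
      using l(2)[of "(x t, e t)"] by linarith
    with disturbance_bound_nonneg show ?thesis
      using norm_bound_of_Lyapunov_bound[OF l(1) onorm_pos_le[OF H(1)] \<alpha> m norm_ge_zero]
      by (simp add: c1_def c2_def W_def)
  qed
  moreover have "0 < c1" "0 < c2"
    using onorm_pos_le[OF H(1)] l(1) \<alpha> m by (simp_all add: c1_def c2_def add_nonneg_pos)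
  then have "class_KL (\<lambda>r t. c1 * r * exp (- (\<alpha> / 2) * t))" "class_K (\<lambda>r. c2 * r)"
    using \<alpha> class_KL_exp_decay[of c1 "\<alpha> / 2"] class_K_scale[of c2] by simp_all
  ultimately show ?thesis unfolding ISS_wrt_def by blast
qed

lemma diagonal_Lyapunov_form:
  fixes Q P :: "real^'n::finite^'n"
  assumes Q: "pos_def Q" and P: "pos_def P" and \<kappa>: "0 < \<kappa>"
  defines "H \<equiv> \<lambda>y. (Q *v fst y, \<kappa> *\<^sub>R (P *v snd y))"
  shows "bounded_linear H" "\<And>a b. a \<bullet> H b = H a \<bullet> b" "\<And>y. y \<noteq> 0 \<Longrightarrow> 0 < y \<bullet> H y"
proof -
  show "bounded_linear H"
    unfolding H_def by (intro bounded_linear_Pair bounded_linear_compose[OF matrix_vector_mul_bounded_linear]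
        bounded_linear_fst bounded_linear_snd bounded_linear_compose[OF bounded_linear_scaleR_right])
  have "sym_mat Q" "sym_mat P" using Q P by (simp_all add: pos_def_def)
  then show "a \<bullet> H b = H a \<bullet> b" for a b
    by (cases a, cases b) (simp add: H_def sym_mat_inner)
  show "0 < y \<bullet> H y" if "y \<noteq> 0" for y
  proof (cases y)
    case (Pair a b)
    have "0 \<le> a \<bullet> (Q *v a)" "0 \<le> b \<bullet> (P *v b)"
      using Q P by (metis inner_zero_left less_eq_real_def pos_def_def)+
    moreover have "0 < a \<bullet> (Q *v a) \<or> 0 < b \<bullet> (P *v b)"
      using that Q P by (metis Pair pos_def_def zero_prod_def)
    ultimately show ?thesis using \<kappa> by (auto simp: H_def Pair add_pos_nonneg add_nonneg_pos)
  qed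
qed

theorem theorem1:
  fixes A :: "real^'x^'x" and B :: "real^'u^'x" and E :: "real^'p^'x" and Ew :: "real^'w^'x"
    and C :: "real^'x^'y" and D :: "real^'u^'y" and Fw :: "real^'w^'y" and Cq :: "real^'x^'q"
    and p :: "real^'q \<Rightarrow> real^'p"
    and N1 N2 :: "((real^'q^'q) \<times> (real^'p^'p)) set"
    and T1 T2 :: "real^('q + 'p)^('q + 'p)"
    and \<alpha>1 \<alpha>2 \<mu>1 \<mu>2 :: real
    and R1 :: "real^'y^'x" and R2 :: "real^'y^'q" and R3 :: "real^'x^'u" and R4 :: "real^'p^'u"
    and P1 P2 :: "real^'x^'x" and X1 X2 :: "real^'q^'q" and Y1 Y2 :: "real^'p^'p"
    and K1 :: "real^'x^'u" and K2 :: "real^'p^'u" and L1 :: "real^'y^'q" and L2 :: "real^'y^'x"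
  assumes p0: "p 0 = 0"
    and A1: "assumption_A1 p N1 T1"
    and A2: "assumption_A2 p N2 T2"
    and M24: "neg_def (blk4 (transpose T2 ** blk (matrix_inv X2) 0 0 (- matrix_inv Y2) ** T2))"
    and pos: "\<alpha>1 > 0" "\<alpha>2 > 0" "\<mu>1 > 0" "\<mu>2 > 0"
    and P1: "pos_def P1" and P2: "pos_def P2"
    and X1: "pos_def X1" and Y1: "sym_mat Y1"
    and X2: "pos_def X2" and Y2: "pos_def Y2"
    and N1: "(X1, Y1) \<in> N1" and N2: "(X2, Y2) \<in> N2"
    and LMI1: "neg_semidef (LMI1 A E Ew C Fw Cq T1 \<alpha>1 \<mu>1 P1 R1 R2 X1 Y1)"
    and LMI2: "neg_semidef (LMI2 A B E Ew Cq T2 \<alpha>2 \<mu>2 P2 R3 R4 X2 Y2)"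
    and L1: "L1 = matrix_inv (Gam1 T1) ** matrix_inv X1 ** R2"
    and L2: "L2 = matrix_inv P1 ** R1 + E ** matrix_inv (blk4 T1) ** blk3 T1 ** L1"
    and K1: "K1 = R3 ** matrix_inv P2 + K2 ** matrix_inv (blk4 T2) ** blk3 T2 ** Cq"
    and K2: "K2 = R4 ** matrix_inv Y2 ** blk4 T2"
  shows "ISS_wrt (closed_loop_sol A B E Ew C Fw Cq p K1 K2 L1 L2)"
proof -
  have "delta_MM p (transpose T2 ** blk (matrix_inv X2) 0 0 (- matrix_inv Y2) ** T2)"
    using A2 N2 by (auto simp: assumption_A2_def)
  then obtain Lp where Lp: "Lp-lipschitz_on UNIV p" using delta_MM_lipschitz M24 by blast
  have Q: "pos_def (matrix_inv P2)" using P2 by (rule pos_def_matrix_inv)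
  obtain \<kappa> where \<kappa>: "0 < \<kappa>" and dissipative:
    "\<And>y w. 2 * ((matrix_inv P2 *v fst y, \<kappa> *\<^sub>R (P1 *v snd y)) \<bullet> closed_loop_field A B E Ew C Fw Cq p K1 K2 L1 L2 y w)
       \<le> - (min \<alpha>1 \<alpha>2 / 2) * (y \<bullet> (matrix_inv P2 *v fst y, \<kappa> *\<^sub>R (P1 *v snd y))) + (\<mu>2 + \<kappa> * \<mu>1) * (norm w)\<^sup>2"
    using closed_loop_dissipation[OF Q P1 pos(1,2) Lp
        state_feedback_dissipation[OF p0 A2 N2 P2 X2 Y2 LMI2 K1 K2]
        observer_dissipation[OF A1 N1 P1 X1 LMI1 L1 L2]] by blast
  obtain L where L: "L-lipschitz_on UNIV (\<lambda>(y, w). closed_loop_field A B E Ew C Fw Cq p K1 K2 L1 L2 y w)"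
    using lipschitz_closed_loop_field[OF Lp] by blast
  show ?thesis
    using pos \<kappa> by (intro ISS_wrt_of_quadratic_Lyapunov_function[OF closed_loop_sol_has_integral L
        closed_loop_field_zero[of p, OF p0] diagonal_Lyapunov_form[OF Q P1 \<kappa>] dissipative]) simp_all
qed

end
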